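(* Let $F$ be a field of characteristic $p\ge0$, let $q\in\Lambda(n)$ with $(q,p)=1$ and let $\lambda=\lambda(q)$. Then $\{\omega_q Q_T: T\in\Gamma(\lambda)\}$ is an $F$-basis of $\mathrm{Lie}_F(q)=\omega_qFS_n$. In particular $\dim_F\mathrm{Lie}_F(q)=\frac{n!}{q?}$, the number of permutations of $S_n$ of cycle type $\lambda$.
   Context: Permutations act on the right and are composed left to right; a permutation $\sigma\in S_n$ is identified with the word $(1)\sigma(2)\sigma\cdots(n)\sigma$, and a word whose letters are $1,\dots,n$ each once is identified with a permutation. Compositions $q=(q_1,\dots,q_k)$ of $n$; $q^+_j=q_1+\dots+q_j$; $m_i(q)$ = number of parts equal to $i$; $(q,p)=1$ means $p\nmid q_i$ for all $i$ (vacuous if $p=0$); $\lambda(q)$ is the partition obtained by rearranging $q$; $q?=\prod_i i^{m_i(q)}m_i(q)!$. $\Xi^q$ = sum of all $\sigma\in S_n$ whose descents (positions $i$ with $(i)\sigma>(i+1)\sigma$) lie in $\{q^+_1,\dots,q^+_k\}$. $\omega_m=(1-c_m)(1-c_{m-1})\cdots(1-c_2)\in FS_m$, $c_i=(i,i-1,\dots,1)$; $\sigma^{+r}$ maps $i+r\mapsto(i)\sigma+r$ for $i\le m$ and fixes the rest; $\omega^q=\omega_{q_1}^{+q^+_0}\cdots\omega_{q_k}^{+q^+_{k-1}}$, $\omega_q=\omega^q\Xi^q$. For a word $w=w_1\cdots w_m$ of distinct positive integers, $S_m$ acts by $\tau\cdot w=w_{(1)\tau}\cdots w_{(m)\tau}$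 (extended linearly), and $Q_w=\omega_m\cdot w$. For a partition $\lambda$ of $n$, $\Gamma(\lambda)$ is the set of tuples $T=(T_{n,1},\dots,T_{n,m_n(\lambda)},\dots,T_{1,1},\dots,T_{1,m_1(\lambda)})$ where each $T_{i,j}$ is a sequence of length $i$ of positive integers, all entries of all $T_{i,j}$ together are exactly $1,\dots,n$ each once, the first entry of each $T_{i,j}$ is its minimum, and $\min T_{i,1}<\min T_{i,2}<\dots<\min T_{i,m_i(\lambda)}$ for each $i$. Then $Q_T=Q_{T_{n,1}}\cdots Q_{T_{1,m_1(\lambda)}}$ (product = concatenation of words, extended bilinearly), regarded as an element of $FS_n$, and $\omega_qQ_T$ is a product in $FS_n$. *)

theory Defs
  imports Complex_Main "HOL-Library.Multiset" "HOL-Library.Function_Algebras"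
begin

text \<open>Elements of FS_n, and more generally formal F-linear combinations of words,
  are represented as functions nat list => F (coefficient of each word).
  A permutation of S_n is represented by its word (1)s (2)s ... (n)s.\<close>

type_synonym 'a comb = "nat list \<Rightarrow> 'a"

definition perms :: "nat \<Rightarrow> nat list set" where
  "perms n = {w. distinct w \<and> set w = {1..n}}"

definition delta :: "nat list \<Rightarrow> 'a::field comb" where
  "delta w = (\<lambda>u. if u = w then 1 else 0)"

text \<open>Right action, composition left to right: (i)(u v) = ((i)u)v.\<close>
definition perm_mult :: "nat list \<Rightarrow> nat list \<Rightarrow> nat list" where
  "perm_mult u v = map (\<lambda>j. v ! (j - 1)) u"

definition conv :: "nat \<Rightarrow> 'a::field comb \<Rightarrow> 'a comb \<Rightarrow> 'a comb" where
  "conv n x y = (\<lambda>w. \<Sum>u\<in>perms n. \<Sum>v\<in>perms n.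
      if perm_mult u v = w then x u * y v else 0)"

definition one :: "nat \<Rightarrow> 'a::field comb" where
  "one n = delta [1..<n+1]"

definition group_alg :: "nat \<Rightarrow> 'a::field comb set" where
  "group_alg n = {x. \<forall>w. w \<notin> perms n \<longrightarrow> x w = 0}"

definition prodl :: "nat \<Rightarrow> 'a::field comb list \<Rightarrow> 'a comb" where
  "prodl n xs = foldr (conv n) xs (one n)"

text \<open>c_i = (i, i-1, ..., 1) in S_m, as a word.\<close>
definition cyc :: "nat \<Rightarrow> nat \<Rightarrow> nat list" where
  "cyc m i = i # [1..<i] @ [i+1..<m+1]"

definition omega :: "nat \<Rightarrow> 'a::field comb" where
  "omega m = prodl m (map (\<lambda>i. one m - delta (cyc m i)) (rev [2..<m+1]))"

definition shiftw :: "nat \<Rightarrow> nat \<Rightarrow> nat list \<Rightarrow> nat list" where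
  "shiftw n r s = [1..<r+1] @ map (\<lambda>j. j + r) s @ [r + length s + 1..<n+1]"

definition shift :: "nat \<Rightarrow> nat \<Rightarrow> nat \<Rightarrow> 'a::field comb \<Rightarrow> 'a comb" where
  "shift n r m x = (\<lambda>w. \<Sum>s\<in>perms m. if shiftw n r s = w then x s else 0)"

definition composition :: "nat \<Rightarrow> nat list \<Rightarrow> bool" where
  "composition n q \<longleftrightarrow> (\<forall>i\<in>set q. 0 < i) \<and> sum_list q = n"

definition psum :: "nat list \<Rightarrow> nat \<Rightarrow> nat" where
  "psum q j = sum_list (take j q)"

definition omega_up :: "nat \<Rightarrow> nat list \<Rightarrow> 'a::field comb" where
  "omega_up n q = prodl n (map (\<lambda>j. shift n (psum q j) (q ! j) (omega (q ! j))) [0..<length q])"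

definition descents :: "nat list \<Rightarrow> nat set" where
  "descents w = {i. 1 \<le> i \<and> i < length w \<and> w ! (i - 1) > w ! i}"

definition Xi :: "nat \<Rightarrow> nat list \<Rightarrow> 'a::field comb" where
  "Xi n q = (\<lambda>w. if w \<in> perms n \<and> descents w \<subseteq> {psum q j | j. 1 \<le> j \<and> j \<le> length q}
                 then 1 else 0)"

definition omega_q :: "nat \<Rightarrow> nat list \<Rightarrow> 'a::field comb" where
  "omega_q n q = conv n (omega_up n q) (Xi n q)"

definition Lie :: "nat \<Rightarrow> nat list \<Rightarrow> 'a::field comb set" where
  "Lie n q = {conv n (omega_q n q) x | x. x \<in> group_alg n}"

definition act :: "nat \<Rightarrow> 'a::field comb \<Rightarrow> nat list \<Rightarrow> 'a comb" where
  "act m x w = (\<lambda>u. \<Sum>t\<in>perms m. if map (\<lambda>j. w ! (j - 1)) t = u then x t else 0)"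

definition Qw :: "nat list \<Rightarrow> 'a::field comb" where
  "Qw w = act (length w) (omega (length w)) w"

text \<open>Bilinear extension of concatenation of words.\<close>
definition cat :: "'a::field comb \<Rightarrow> 'a comb \<Rightarrow> 'a comb" where
  "cat x y = (\<lambda>u. \<Sum>i\<le>length u. x (take i u) * y (drop i u))"

text \<open>Q_T for T given as the list [T_{n,1}, ..., T_{1,m_1}].\<close>
definition QT :: "nat list list \<Rightarrow> 'a::field comb" where
  "QT Ts = foldr (\<lambda>w acc. cat (Qw w) acc) Ts (delta [])"

definition lam :: "nat list \<Rightarrow> nat list" where
  "lam q = rev (sort q)"

definition Gamma :: "nat \<Rightarrow> nat list \<Rightarrow> nat list list set" where
  "Gamma n la = {Ts. map length Ts = la \<and> distinct (concat Ts) \<and> set (concat Ts) = {1..n}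
      \<and> (\<forall>T\<in>set Ts. hd T = Min (set T))
      \<and> (\<forall>k. Suc k < length Ts \<longrightarrow> length (Ts ! k) = length (Ts ! Suc k)
              \<longrightarrow> hd (Ts ! k) < hd (Ts ! Suc k))}"

definition qq :: "nat list \<Rightarrow> nat" where
  "qq q = (\<Prod>i\<in>set q. i ^ count_list q i * fact (count_list q i))"

definition cycle_type :: "nat list \<Rightarrow> nat multiset" where
  "cycle_type w = image_mset card (mset_set
     ((\<lambda>i. {((\<lambda>j. w ! (j - 1)) ^^ k) i | k. True}) ` {1..length w}))"

definition scl :: "'a::field \<Rightarrow> 'a comb \<Rightarrow> 'a comb" where
  "scl c x = (\<lambda>u. c * x u)"

end

theory Submission
  imports Defs "HOL-Combinatorics.Multiset_Permutations" "HOL-Library.Product_Lexorder"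
begin

text \<open>
  Acting on a word \<open>w\<close>, \<open>\<Xi>\<^sup>q\<close> splits \<open>w\<close> in all ways into subwords of lengths \<open>q\<^sub>1, \<dots>, q\<^sub>k\<close>
  and \<open>\<omega>\<^sup>q\<close> replaces each subword by its left-normed bracket; so \<open>\<omega>\<^sub>q\<close> is the convolution product
  of the homogeneous Dynkin operators with respect to the unshuffle coproduct. Lie elements are
  primitive for that coproduct. Hence, for a product of \<open>k\<close> Lie elements whose degrees are a
  rearrangement of \<open>q\<close>, only the terms that distribute the factors bijectively to the \<open>k\<close> slots
  survive, and by the Dynkin--Specht--Wever identity \<open>\<omega>\<^sub>q Q\<^sub>T\<close> is \<open>q\<^sub>1 \<cdots> q\<^sub>k\<close> times the sum of the
  products of the block brackets over all admissible orders. The scalar is invertible since \<open>p\<close> divides no \<open>q\<^sub>i\<close>.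

  Brackets starting with their smallest letter are dual to words starting with their smallest
  letter. This makes the symmetrised products independent, and expanding each bracket of a
  subword of \<open>w\<close> in this dual basis shows that they span. Indexing them by unordered sets of
  words also gives the counting recursion and the bijection with cycle decompositions.
\<close>

section \<open>Concatenation and linear extension\<close>

text \<open>Left multiplication in FS_n permutes places, whereas brackets, restriction and
  concatenation concern letters. The link is to read a product x y as the action of x on every word
  of y; the identities themselves are then about combinations of words. Recursion on
  \<open>q\<close> passes to subwords, so these identities are proved for words on any finite set of
  distinct letters instead of \<open>{1..n}\<close>. In this multilinear setting the unshuffle
  coproduct is restriction of words to a set \<open>B\<close> of letters and to its complement.
  Testing against an arbitrary scalar function of the two restrictions replaces tensor products.

  Independence and spanning are both explicit and neither rests on a dimension count: the
  coefficients that occur are bracket coefficients, which are integers and do not see the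
  characteristic. The coprimality hypothesis enters through the scalar of
  \<open>conv_omega_q_QT\<close>.

  The operator prescribes block lengths in the order of \<open>q\<close>, while \<open>Gamma\<close>
  lists blocks by decreasing length; forgetting the order of the blocks reconciles the two.\<close>

lemma perms_eq: "perms n = permutations_of_set {1..n}"
  by (auto simp: perms_def permutations_of_set_def)

lemma cat_Nil [simp]: "cat x y [] = x [] * y []"
  by (simp add: cat_def)

text \<open>The cut before the first letter is split off; every other cut leaves \<open>a\<close> in
  the left factor. This recursion by left derivatives lets identities for \<open>cat\<close> be
  proved by induction on the word instead of by reindexing cut positions.\<close>

lemma cat_Cons: "cat x y (a # u) = x [] * y (a # u) + cat (\<lambda>w. x (a # w)) y u"
proof -
  have "{..length (a # u)} = insert 0 (Suc ` {..length u})"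
    by (simp add: atMost_Suc_eq_insert_0)
  then show ?thesis
    by (simp add: cat_def sum.reindex)
qed

lemma cat_zero_left [simp]: "cat (\<lambda>w. 0) y u = 0"
  by (simp add: cat_def)

lemma cat_zero_right [simp]: "cat y (\<lambda>w. 0) u = 0"
  by (simp add: cat_def)

lemma cat_add_left: "cat (\<lambda>w. x w + y w) z u = cat x z u + cat y z u"
  by (simp add: cat_def sum.distrib ring_distribs)

lemma cat_diff_left: "cat (\<lambda>w. x w - y w) z u = cat x z u - cat y z u"
  by (simp add: cat_def sum_subtractf ring_distribs)

lemma cat_diff_right: "cat z (\<lambda>w. x w - y w) u = cat z x u - cat z y u"
  by (simp add: cat_def sum_subtractf ring_distribs)

lemma cat_mult_left: "cat (\<lambda>w. c * x w) y u = c * cat x y u"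
  by (simp add: cat_def sum_distrib_left mult_ac)

lemma cat_mult_right: "cat x (\<lambda>w. c * y w) u = c * cat x y u"
  by (simp add: cat_def sum_distrib_left mult_ac)

lemma cat_sum_left: "cat (\<lambda>w. \<Sum>i\<in>I. f i w) y u = (\<Sum>i\<in>I. cat (f i) y u)"
  unfolding cat_def sum_distrib_right by (rule sum.swap)

lemma cat_sum_right: "cat y (\<lambda>w. \<Sum>i\<in>I. f i w) u = (\<Sum>i\<in>I. cat y (f i) u)"
  unfolding cat_def sum_distrib_left by (rule sum.swap)

lemma cat_assoc_apply: "cat (cat x y) z u = cat x (cat y z) u"
proof (induction u arbitrary: x)
  case (Cons a u)
  have "(\<lambda>w. cat x y (a # w)) = (\<lambda>w. x [] * y (a # w) + cat (\<lambda>v. x (a # v)) y w)"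
    by (simp add: cat_Cons)
  then show ?case
    by (simp add: cat_Cons cat_add_left cat_mult_left Cons algebra_simps)
qed simp

lemma cat_assoc: "cat (cat x y) z = cat x (cat y z)"
  by (rule ext) (rule cat_assoc_apply)

lemma delta_same [simp]: "delta w w = 1"
  by (simp add: delta_def)

lemma cat_delta_Nil_left [simp]: "cat (delta []) y = y"
proof
  show "cat (delta []) y u = y u" for u
    by (cases u) (simp_all add: cat_Cons delta_def)
qed

lemma cat_delta_Cons: "cat (delta (a # v)) y (b # u) = (if a = b then cat (delta v) y u else 0)"
proof -
  have "(\<lambda>w. delta (a # v) (b # w)) = (if a = b then delta v else (\<lambda>w. 0))"
    by (auto simp: delta_def)
  then show ?thesis by (simp add: cat_Cons) (simp add: delta_def)
qed

lemma cat_delta_delta: "cat (delta v) (delta w) = delta (v @ w)"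
proof
  show "cat (delta v) (delta w) u = delta (v @ w) u" for u
  proof (induction v arbitrary: u)
    case (Cons a v)
    then show ?case by (cases u) (simp_all add: cat_delta_Cons, simp_all add: delta_def)
  qed simp
qed

lemma cat_delta_Nil_right [simp]: "cat y (delta []) = y"
proof
  show "cat y (delta []) u = y u" for u
    by (induction u arbitrary: y) (simp_all add: cat_Cons delta_def)
qed

lemma cat_length_left:
  assumes "\<And>w. length w \<noteq> m \<Longrightarrow> x w = 0" and "length v = m"
  shows "cat x y (v @ u) = x v * y u"
proof -
  have "cat x y (v @ u) = (\<Sum>i\<in>{m}. x (take i (v @ u)) * y (drop i (v @ u)))"
    unfolding cat_def by (rule sum.mono_neutral_right) (use assms in auto)
  then show ?thesis using assms by simp
qed

section \<open>Multilinear elements on a letter set and linear extension\<close>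

definition supported :: "nat set \<Rightarrow> 'a::field comb \<Rightarrow> bool" where
  "supported A y \<longleftrightarrow> (\<forall>w. w \<notin> permutations_of_set A \<longrightarrow> y w = 0)"

text \<open>Extension is tested one scalar at a time: a map from words to combinations is handled by
  taking for \<open>g\<close> its coefficient at a fixed word \<open>z\<close>.\<close>

definition lext :: "nat set \<Rightarrow> 'a::field comb \<Rightarrow> (nat list \<Rightarrow> 'a) \<Rightarrow> 'a" where
  "lext A y g = (\<Sum>w\<in>permutations_of_set A. y w * g w)"

lemma lext_cong:
  assumes "\<And>w. w \<in> permutations_of_set A \<Longrightarrow> g w = h w"
  shows "lext A y g = lext A y h"
  unfolding lext_def by (rule sum.cong) (use assms in auto)

lemma lext_zero [simp]: "lext A y (\<lambda>w. 0) = 0"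
  by (simp add: lext_def)

lemma lext_diff: "lext A y (\<lambda>w. g w - h w) = lext A y g - lext A y h"
  by (simp add: lext_def sum_subtractf ring_distribs)

lemma lext_diff_left: "lext A (\<lambda>w. x w - y w) g = lext A x g - lext A y g"
  by (simp add: lext_def sum_subtractf ring_distribs)

lemma lext_sum: "lext A y (\<lambda>w. \<Sum>i\<in>I. g i w) = (\<Sum>i\<in>I. lext A y (g i))"
  unfolding lext_def sum_distrib_left by (rule sum.swap)

lemma lext_swap: "lext A x (\<lambda>u. lext B y (\<lambda>v. g u v)) = lext B y (\<lambda>v. lext A x (\<lambda>u. g u v))"
  unfolding lext_def sum_distrib_left
  by (subst sum.swap) (simp add: mult_ac)

lemma lext_delta:
  assumes "distinct w" "set w = A"
  shows "lext A (delta w) g = g w"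
proof -
  have "lext A (delta w) g = (\<Sum>v\<in>permutations_of_set A. if v = w then g v else 0)"
    unfolding lext_def by (rule sum.cong) (simp_all add: delta_def)
  also have "\<dots> = g w"
    using assms by (subst sum.delta) auto
  finally show ?thesis .
qed

lemma lext_delta_right:
  assumes "supported A y"
  shows "lext A y (\<lambda>w. delta w z) = y z"
proof -
  have "lext A y (\<lambda>w. delta w z) = (\<Sum>v\<in>permutations_of_set A. if z = v then y v else 0)"
    unfolding lext_def by (rule sum.cong) (simp_all add: delta_def)
  then show ?thesis
    using assms by (simp add: sum.delta' supported_def)
qed

lemma supported_cat:
  assumes "supported A x" "supported B y" "A \<inter> B = {}"
  shows "supported (A \<union> B) (cat x y)"
  unfolding supported_def
proof (intro allI impI)
  fix w assume w: "w \<notin> permutations_of_set (A \<union> B)"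
  have "x (take i w) * y (drop i w) = 0" for i
  proof (rule ccontr)
    assume "x (take i w) * y (drop i w) \<noteq> 0"
    then have "take i w \<in> permutations_of_set A" "drop i w \<in> permutations_of_set B"
      using assms by (auto simp: supported_def)
    then have "take i w @ drop i w \<in> permutations_of_set (A \<union> B)"
      using assms(3) unfolding permutations_of_set_def mem_Collect_eq distinct_append set_append by blast
    then show False using w by simp
  qed
  then show "cat x y w = 0" unfolding cat_def by (intro sum.neutral) blast
qed

lemma supported_delta: "distinct w \<Longrightarrow> supported (set w) (delta w)"
  by (simp add: supported_def delta_def permutations_of_set_def)

lemma supported_diff: "supported A x \<Longrightarrow> supported A y \<Longrightarrow> supported A (\<lambda>w. x w - y w)"
  by (simp add: supported_def)

lemma supported_length:
  assumes "supported A x" "length w \<noteq> card A" shows "x w = 0"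
  using assms length_finite_permutations_of_set unfolding supported_def by blast

text \<open>A Fubini rule: as the alphabets are disjoint and all words of the first factor have
  length \<open>card A\<close>, each word of the product splits in a unique way.\<close>

lemma lext_cat:
  assumes x: "supported A x" and y: "supported B y" and AB: "A \<inter> B = {}" and fin: "finite A" "finite B"
  shows "lext (A \<union> B) (cat x y) g = lext A x (\<lambda>u. lext B y (\<lambda>v. g (u @ v)))"
proof -
  let ?P = "permutations_of_set"
  let ?S = "(\<lambda>(u, v). u @ v) ` (?P A \<times> ?P B)"
  have len: "length u = card A" if "u \<in> ?P A" for u using that by (rule length_finite_permutations_of_set)
  have inj: "inj_on (\<lambda>(u, v). u @ v) (?P A \<times> ?P B)"
    using len by (auto simp: inj_on_def)
  have sub: "?S \<subseteq> ?P (A \<union> B)"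
    using AB by (auto simp: permutations_of_set_def)
  have zero: "cat x y w = 0" if "w \<notin> ?S" for w
  proof -
    have "x (take i w) * y (drop i w) = 0" for i
    proof (rule ccontr)
      assume "x (take i w) * y (drop i w) \<noteq> 0"
      then have "(take i w, drop i w) \<in> ?P A \<times> ?P B"
        using x y by (auto simp: supported_def)
      then have "(\<lambda>(u, v). u @ v) (take i w, drop i w) \<in> ?S" by (rule imageI)
      then show False using that by simp
    qed
    then show ?thesis unfolding cat_def by (intro sum.neutral) blast
  qed
  have "lext (A \<union> B) (cat x y) g = (\<Sum>w\<in>?S. cat x y w * g w)"
    unfolding lext_def by (rule sum.mono_neutral_right) (use sub zero fin in auto)
  also have "\<dots> = (\<Sum>(u, v)\<in>?P A \<times> ?P B. cat x y (u @ v) * g (u @ v))"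
    by (subst sum.reindex[OF inj]) (simp add: case_prod_unfold)
  also have "\<dots> = (\<Sum>(u, v)\<in>?P A \<times> ?P B. x u * y v * g (u @ v))"
  proof (rule sum.cong)
    fix p assume "p \<in> ?P A \<times> ?P B"
    then obtain u v where p: "p = (u, v)" "u \<in> ?P A" by auto
    have "cat x y (u @ v) = x u * y v"
      by (rule cat_length_left) (use supported_length[OF x] len[OF p(2)] in auto)
    then show "(case p of (u, v) \<Rightarrow> cat x y (u @ v) * g (u @ v)) = (case p of (u, v) \<Rightarrow> x u * y v * g (u @ v))"
      using p by simp
  qed simp
  also have "\<dots> = lext A x (\<lambda>u. lext B y (\<lambda>v. g (u @ v)))"
    by (simp add: lext_def sum.cartesian_product sum_distrib_left mult_ac)
  finally show ?thesis .
qed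

lemma cat_lext_left: "cat (\<lambda>z. lext A y (\<lambda>w. F w z)) x u = lext A y (\<lambda>w. cat (F w) x u)"
  by (simp add: lext_def cat_sum_left cat_mult_left)

lemma cat_lext_right: "cat x (\<lambda>z. lext A y (\<lambda>w. F w z)) u = lext A y (\<lambda>w. cat x (F w) u)"
  by (simp add: lext_def cat_sum_right cat_mult_right)

section \<open>Left-normed brackets\<close>

definition bracket :: "'a::field comb \<Rightarrow> 'a comb \<Rightarrow> 'a comb" where
  "bracket x y = (\<lambda>u. cat x y u - cat y x u)"

definition ad_word :: "'a::field comb \<Rightarrow> nat list \<Rightarrow> 'a comb" where
  "ad_word = foldl (\<lambda>x a. bracket x (delta [a]))"

text \<open>The empty word gives the unit, not 0, so that \<open>Qw_eq_left_normed\<close> also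
  covers length 0, where \<open>omega 0\<close> is the identity.\<close>

definition left_normed :: "nat list \<Rightarrow> 'a::field comb" where
  "left_normed w = (case w of [] \<Rightarrow> delta [] | a # v \<Rightarrow> ad_word (delta [a]) v)"

lemma ad_word_Nil [simp]: "ad_word x [] = x"
  and ad_word_append: "ad_word x (u @ v) = ad_word (ad_word x u) v"
  and ad_word_single [simp]: "ad_word x [a] = bracket x (delta [a])"
  by (simp_all add: ad_word_def)

lemma left_normed_Nil [simp]: "left_normed [] = delta []"
  and left_normed_Cons: "left_normed (a # v) = ad_word (delta [a]) v"
  by (simp_all add: left_normed_def)

lemma left_normed_append: "u \<noteq> [] \<Longrightarrow> left_normed (u @ v) = ad_word (left_normed u) v"
  by (cases u) (simp_all add: left_normed_Cons ad_word_append)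

lemma left_normed_snoc: "u \<noteq> [] \<Longrightarrow> left_normed (u @ [a]) = bracket (left_normed u) (delta [a])"
  by (simp add: left_normed_append)

lemma supported_bracket: "supported A x \<Longrightarrow> supported B y \<Longrightarrow> A \<inter> B = {} \<Longrightarrow> supported (A \<union> B) (bracket x y)"
  unfolding bracket_def using supported_cat[of A x B y] supported_cat[of B y A x]
  by (auto intro!: supported_diff simp: Un_commute Int_commute)

lemma supported_ad_word:
  "supported A x \<Longrightarrow> distinct w \<Longrightarrow> A \<inter> set w = {} \<Longrightarrow> supported (A \<union> set w) (ad_word x w)"
proof (induction w rule: rev_induct)
  case (snoc a w)
  then have "supported ((A \<union> set w) \<union> set [a]) (bracket (ad_word x w) (delta [a]))"
    by (intro supported_bracket supported_delta) auto
  then show ?case by (simp add: ad_word_append)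
qed simp

lemma supported_left_normed: "distinct w \<Longrightarrow> supported (set w) (left_normed w)"
proof (cases w)
  case (Cons a v)
  assume "distinct w"
  then show ?thesis
    using supported_ad_word[of "set [a]" "delta [a]" v] supported_delta[of "[a]"] Cons by (simp add: left_normed_Cons)
qed (use supported_delta[of "[]"] in simp)

text \<open>The Jacobi identity in the form needed for the right adjoint action: acting by [y, z] is
  acting by y then z, minus acting by z then y.\<close>

lemma bracket_jacobi: "bracket (bracket x y) z u - bracket (bracket x z) y u = bracket x (bracket y z) u"
  unfolding bracket_def by (simp add: cat_diff_left cat_diff_right cat_assoc)

lemma bracket_lext_left: "bracket (\<lambda>z. lext A y (\<lambda>w. F w z)) x u = lext A y (\<lambda>w. bracket (F w) x u)"
  by (simp add: bracket_def cat_lext_left cat_lext_right lext_diff)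

lemma bracket_antisym: "bracket x y u = - bracket y x u"
  by (simp add: bracket_def)

lemma lext_bracket:
  assumes "supported A x" "supported B y" "A \<inter> B = {}" "finite A" "finite B"
  shows "lext (A \<union> B) (bracket x y) g =
    lext A x (\<lambda>u. lext B y (\<lambda>v. g (u @ v))) - lext B y (\<lambda>v. lext A x (\<lambda>u. g (v @ u)))"
  unfolding bracket_def lext_diff_left lext_cat[OF assms]
  using lext_cat[OF assms(2,1) _ assms(5,4), of g] assms(3) by (simp add: Un_commute Int_commute)

text \<open>Since [v, a] = va - av, the last letter is either appended with sign + or prepended with
  sign -. This is the inductive step for the adjoint action, the Dynkin identity and
  primitivity.\<close>

lemma lext_left_normed_snoc:
  assumes "distinct (v @ [a])" "v \<noteq> []"
  shows "lext (set (v @ [a])) (left_normed (v @ [a])) g =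
     lext (set v) (left_normed v) (\<lambda>w. g (w @ [a])) - lext (set v) (left_normed v) (\<lambda>w. g (a # w))"
proof -
  have "lext (set v \<union> set [a]) (bracket (left_normed v) (delta [a])) g =
     lext (set v) (left_normed v) (\<lambda>w. lext (set [a]) (delta [a]) (\<lambda>u. g (w @ u)))
     - lext (set [a]) (delta [a]) (\<lambda>u. lext (set v) (left_normed v) (\<lambda>w. g (u @ w)))"
    by (rule lext_bracket) (use assms supported_left_normed[of v] supported_delta[of "[a]"] in auto)
  then show ?thesis
    using assms(2) by (simp add: left_normed_snoc lext_delta)
qed

text \<open>The adjoint action is multiplicative, so the word-by-word action of a Lie element is a bracket.\<close>

lemma lext_left_normed_ad_word:
  assumes "distinct v" "v \<noteq> []"
  shows "lext (set v) (left_normed v) (\<lambda>w. ad_word x w z) = bracket x (left_normed v) z"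
  using assms(2,1)
proof (induction v arbitrary: x z rule: rev_nonempty_induct)
  case (single a)
  then show ?case using lext_delta[of "[a]" "{a}" "\<lambda>w. ad_word x w z"] by (simp add: left_normed_Cons)
next
  case (snoc a v)
  have IH: "lext (set v) (left_normed v) (\<lambda>w. ad_word x w z) = bracket x (left_normed v) z" for x :: "'a comb" and z
    using snoc by simp
  have "lext (set (v @ [a])) (left_normed (v @ [a])) (\<lambda>w. ad_word x w z) =
    lext (set v) (left_normed v) (\<lambda>w. bracket (ad_word x w) (delta [a]) z)
    - lext (set v) (left_normed v) (\<lambda>w. ad_word (bracket x (delta [a])) w z)"
    using snoc ad_word_append[of x "[a]"] by (subst lext_left_normed_snoc) (simp_all add: ad_word_append)
  also have "\<dots> = bracket (bracket x (left_normed v)) (delta [a]) z - bracket (bracket x (delta [a])) (left_normed v) z"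
    by (simp add: IH flip: bracket_lext_left)
  also have "\<dots> = bracket x (left_normed (v @ [a])) z"
    using snoc by (simp add: bracket_jacobi left_normed_snoc)
  finally show ?case .
qed

text \<open>Split [v, a] = va - av. On the words ending in \<open>a\<close>, induction gives
  \<open>length v\<close> times [v, a]; on the words starting with \<open>a\<close>, the adjoint
  action gives [a, v], and the sign turns this into one more copy.\<close>

lemma dynkin:
  assumes "distinct v" "v \<noteq> []"
  shows "lext (set v) (left_normed v) (\<lambda>w. left_normed w z) = of_nat (length v) * left_normed v z"
  using assms(2,1)
proof (induction v arbitrary: z rule: rev_nonempty_induct)
  case (single a)
  then show ?case using lext_delta[of "[a]" "{a}" "\<lambda>w. left_normed w z"] by (simp add: left_normed_Cons)
next
  case (snoc a v)
  have IH: "(\<lambda>z. lext (set v) (left_normed v) (\<lambda>w. left_normed w z)) = (\<lambda>z. of_nat (length v) * (left_normed v z :: 'a))"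
    using snoc by auto
  have ne: "w \<noteq> []" if "w \<in> permutations_of_set (set v)" for w
    using that snoc by (auto simp: permutations_of_set_def)
  have "lext (set (v @ [a])) (left_normed (v @ [a])) (\<lambda>w. left_normed w z :: 'a) =
    lext (set v) (left_normed v) (\<lambda>w. bracket (left_normed w) (delta [a]) z)
    - lext (set v) (left_normed v) (\<lambda>w. ad_word (delta [a]) w z)"
    using snoc by (subst lext_left_normed_snoc) (auto simp: left_normed_snoc ne left_normed_Cons intro!: lext_cong)
  also have "\<dots> = bracket (\<lambda>z. of_nat (length v) * left_normed v z) (delta [a]) z - bracket (delta [a]) (left_normed v) z"
    using snoc by (simp add: lext_left_normed_ad_word IH flip: bracket_lext_left)
  also have "\<dots> = of_nat (length (v @ [a])) * left_normed (v @ [a]) z"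
    using snoc by (simp add: bracket_def left_normed_snoc cat_mult_left cat_mult_right algebra_simps)
  finally show ?case .
qed

section \<open>Primitivity and the Dynkin operators\<close>

text \<open>Lie elements are primitive for the unshuffle coproduct.\<close>

lemma lext_left_normed_primitive:
  fixes g :: "nat list \<Rightarrow> nat list \<Rightarrow> 'a::field"
  assumes "distinct v" "B \<inter> set v \<noteq> {}" "\<not> set v \<subseteq> B"
  shows "lext (set v) (left_normed v) (\<lambda>w. g (filter (\<lambda>x. x \<in> B) w) (filter (\<lambda>x. x \<notin> B) w)) = 0"
  using assms
proof (induction v arbitrary: g rule: rev_induct)
  case (snoc a v)
  have ne: "v \<noteq> []" using snoc.prems by auto
  note eq = lext_left_normed_snoc[OF snoc.prems(1) ne]
  have IH: "lext (set v) (left_normed v) (\<lambda>w. h (filter (\<lambda>x. x \<in> B) w) (filter (\<lambda>x. x \<notin> B) w)) = 0"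
    if "B \<inter> set v \<noteq> {}" "\<not> set v \<subseteq> B" for h :: "nat list \<Rightarrow> nat list \<Rightarrow> 'a"
    using snoc that by simp
  \<comment> \<open>If \<open>a\<close> is alone on its side of \<open>B\<close>, then
    \<open>w @ [a]\<close> and \<open>a # w\<close> have the same two restrictions and the terms
    cancel. Otherwise \<open>B\<close> already cuts \<open>v\<close>, and both terms vanish by
    induction.\<close>
  consider "a \<in> B" "B \<inter> set v = {}" | "a \<notin> B" "set v \<subseteq> B" | "B \<inter> set v \<noteq> {}" "\<not> set v \<subseteq> B"
    using snoc.prems by auto
  then show ?case
  proof cases
    case 1
    have "filter (\<lambda>x. x \<in> B) w = []" if "w \<in> permutations_of_set (set v)" for w
      using 1 that by (auto simp: permutations_of_set_def filter_empty_conv)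
    then show ?thesis
      unfolding eq using 1 by (simp cong: lext_cong)
  next
    case 2
    have "filter (\<lambda>x. x \<notin> B) w = []" if "w \<in> permutations_of_set (set v)" for w
      using 2 that by (auto simp: permutations_of_set_def filter_empty_conv)
    then show ?thesis
      unfolding eq using 2 by (simp cong: lext_cong)
  next
    case 3
    then show ?thesis
      using IH[of "\<lambda>u w. g (u @ [a]) w"] IH[of "\<lambda>u w. g (a # u) w"]
        IH[of "\<lambda>u w. g u (w @ [a])"] IH[of "\<lambda>u w. g u (a # w)"]
      unfolding eq by simp
  qed
qed simp

section \<open>Products of Lie elements under the coproduct\<close>

definition left_normed_prod :: "nat list list \<Rightarrow> 'a::field comb" where
  "left_normed_prod Ts = foldr (\<lambda>w. cat (left_normed w)) Ts (delta [])"

lemma left_normed_prod_Nil [simp]: "left_normed_prod [] = delta []"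
  and left_normed_prod_Cons [simp]: "left_normed_prod (t # Ts) = cat (left_normed t) (left_normed_prod Ts)"
  by (simp_all add: left_normed_prod_def)

lemma supported_left_normed_prod: "distinct (concat Ts) \<Longrightarrow> supported (set (concat Ts)) (left_normed_prod Ts)"
proof (induction Ts)
  case Nil
  then show ?case using supported_delta[of "[]"] by simp
next
  case (Cons t Ts)
  then show ?case
    using supported_cat[OF supported_left_normed, of t "set (concat Ts)" "left_normed_prod Ts"] by simp
qed

lemma lext_left_normed_prod_Cons:
  assumes "distinct (concat (t # Ts))"
  shows "lext (set (concat (t # Ts))) (left_normed_prod (t # Ts)) g =
    lext (set t) (left_normed t) (\<lambda>u. lext (set (concat Ts)) (left_normed_prod Ts) (\<lambda>v. g (u @ v)))"
  using lext_cat[OF supported_left_normed supported_left_normed_prod, of t Ts g] assms by simp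

lemma distinct_concat_filter: "distinct (concat Ts) \<Longrightarrow> distinct (concat (filter P Ts))"
  by (induction Ts) auto

lemma lext_if: "lext A y (\<lambda>w. if P then g w else 0) = (if P then lext A y g else 0)"
  by simp

text \<open>Restriction to a letter set is compatible with concatenation, so primitivity applies
  block by block: a block cut by \<open>B\<close> annihilates everything, and any other block passes
  whole to one side, the order of blocks being kept.\<close>

lemma lext_left_normed_prod_split:
  fixes B :: "nat set" and g :: "nat list \<Rightarrow> nat list \<Rightarrow> 'a::field"
  assumes "distinct (concat Ts)"
  defines "inB \<equiv> filter (\<lambda>t. set t \<subseteq> B)" and "offB \<equiv> filter (\<lambda>t. \<not> set t \<subseteq> B)"
  shows "lext (set (concat Ts)) (left_normed_prod Ts) (\<lambda>w. g (filter (\<lambda>x. x \<in> B) w) (filter (\<lambda>x. x \<notin> B) w)) =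
    (if \<forall>t\<in>set Ts. set t \<subseteq> B \<or> B \<inter> set t = {}
     then lext (set (concat (inB Ts))) (left_normed_prod (inB Ts))
       (\<lambda>u. lext (set (concat (offB Ts))) (left_normed_prod (offB Ts)) (\<lambda>v. g u v))
     else 0)"
  using assms(1)
proof (induction Ts arbitrary: g)
  case Nil
  then show ?case by (simp add: inB_def offB_def lext_delta[of "[]"])
next
  case (Cons t Ts)
  let ?i = "filter (\<lambda>x. x \<in> B)" and ?o = "filter (\<lambda>x. x \<notin> B)"
  let ?A = "set (concat Ts)"
  have d: "distinct (concat (inB (t # Ts)))" "distinct (concat (offB (t # Ts)))"
    using Cons.prems unfolding inB_def offB_def by (blast intro: distinct_concat_filter)+
  have IH: "lext ?A (left_normed_prod Ts) (\<lambda>w. h (?i w) (?o w)) =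
    (if \<forall>t\<in>set Ts. set t \<subseteq> B \<or> B \<inter> set t = {}
     then lext (set (concat (inB Ts))) (left_normed_prod (inB Ts))
       (\<lambda>u. lext (set (concat (offB Ts))) (left_normed_prod (offB Ts)) (\<lambda>v. h u v))
     else 0)" for h :: "nat list \<Rightarrow> nat list \<Rightarrow> 'a"
    using Cons by simp
  have eq: "lext (set (concat (t # Ts))) (left_normed_prod (t # Ts)) (\<lambda>w. g (?i w) (?o w)) =
    lext (set t) (left_normed t) (\<lambda>u. lext ?A (left_normed_prod Ts) (\<lambda>v. g (?i u @ ?i v) (?o u @ ?o v)))"
    by (subst lext_left_normed_prod_Cons[OF Cons.prems]) simp
  consider (sub) "set t \<subseteq> B" | (off) "\<not> set t \<subseteq> B" "B \<inter> set t = {}" | (cut) "B \<inter> set t \<noteq> {}" "\<not> set t \<subseteq> B"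
    by blast
  then show ?case
  proof cases
    case sub
    have "?i u = u \<and> ?o u = []" if "u \<in> permutations_of_set (set t)" for u
      using sub that by (auto simp: permutations_of_set_def filter_empty_conv filter_id_conv)
    then have "lext (set (concat (t # Ts))) (left_normed_prod (t # Ts)) (\<lambda>w. g (?i w) (?o w)) =
      lext (set t) (left_normed t) (\<lambda>u. lext ?A (left_normed_prod Ts) (\<lambda>v. g (u @ ?i v) (?o v)))"
      unfolding eq by (intro lext_cong) simp
    also have "\<dots> = lext (set t) (left_normed t) (\<lambda>u.
      (if \<forall>t\<in>set Ts. set t \<subseteq> B \<or> B \<inter> set t = {}
        then lext (set (concat (inB Ts))) (left_normed_prod (inB Ts))
       (\<lambda>x. lext (set (concat (offB Ts))) (left_normed_prod (offB Ts)) (\<lambda>v. g (u @ x) v))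
     else 0))"
      by (intro lext_cong) (rule IH)
    finally have E: "lext (set (concat (t # Ts))) (left_normed_prod (t # Ts)) (\<lambda>w. g (?i w) (?o w)) = \<dots>" .
    have C: "inB (t # Ts) = t # inB Ts" "offB (t # Ts) = offB Ts"
      using sub by (simp_all add: inB_def offB_def)
    have "distinct (concat (t # inB Ts))" using d C by simp
    note R = lext_left_normed_prod_Cons[OF this]
    show ?thesis
      unfolding E C R lext_if using sub by simp
  next
    case off
    have "?o u = u \<and> ?i u = []" if "u \<in> permutations_of_set (set t)" for u
      using off that by (auto simp: permutations_of_set_def filter_empty_conv filter_id_conv)
    then have "lext (set (concat (t # Ts))) (left_normed_prod (t # Ts)) (\<lambda>w. g (?i w) (?o w)) =
      lext (set t) (left_normed t) (\<lambda>u. lext ?A (left_normed_prod Ts) (\<lambda>v. g (?i v) (u @ ?o v)))"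
      unfolding eq by (intro lext_cong) simp
    also have "\<dots> = lext (set t) (left_normed t) (\<lambda>u.
      (if \<forall>t\<in>set Ts. set t \<subseteq> B \<or> B \<inter> set t = {}
        then lext (set (concat (inB Ts))) (left_normed_prod (inB Ts))
       (\<lambda>x. lext (set (concat (offB Ts))) (left_normed_prod (offB Ts)) (\<lambda>v. g x (u @ v)))
     else 0))"
      by (intro lext_cong) (rule IH)
    finally have E: "lext (set (concat (t # Ts))) (left_normed_prod (t # Ts)) (\<lambda>w. g (?i w) (?o w)) = \<dots>" .
    have C: "inB (t # Ts) = inB Ts" "offB (t # Ts) = t # offB Ts"
      using off by (simp_all add: inB_def offB_def)
    have "distinct (concat (t # offB Ts))" using d C by simp
    note R = lext_left_normed_prod_Cons[OF this]
    \<comment> \<open>The block lies on the complementary side, so its sum has to be moved inside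
      the one over the blocks contained in \<open>B\<close>.\<close>
    show ?thesis
      unfolding E C R lext_if lext_swap[of "set t" "left_normed t" "set (concat (inB Ts))"] using off by simp
  next
    case cut
    have "lext (set t) (left_normed t) (\<lambda>u. lext ?A (left_normed_prod Ts) (\<lambda>v. g (?i u @ ?i v) (?o u @ ?o v))) = 0"
      using Cons.prems by (subst lext_swap) (simp add: lext_left_normed_primitive[OF _ cut, where g = "\<lambda>x y. g (x @ _) (y @ _)"])
    then show ?thesis unfolding eq using cut by auto
  qed
qed

section \<open>Brackets with a prescribed first letter\<close>

lemma cat_delta_single_right:
  "cat x (delta [b]) z = (if z \<noteq> [] \<and> last z = b then x (butlast z) else 0)"
proof (induction z arbitrary: x)
  case (Cons c z)
  then show ?case by (simp add: cat_Cons delta_def)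
qed (simp add: delta_def)

text \<open>Each subtracted term puts a letter other than \<open>a\<close> in front, and later
  bracketing never brings \<open>a\<close> back there. So the only term starting with
  \<open>a\<close> is the word itself.\<close>

lemma left_normed_same_hd:
  assumes "distinct (a # v)"
  shows "left_normed (a # v) (a # u) = (if u = v then 1 else 0 :: 'a::field)"
  using assms
proof (induction v arbitrary: u rule: rev_induct)
  case Nil
  then show ?case by (simp add: left_normed_Cons delta_def)
next
  case (snoc b v)
  have "left_normed (a # v @ [b]) = (bracket (left_normed (a # v)) (delta [b]) :: 'a comb)"
    using left_normed_snoc[of "a # v" b] by simp
  moreover have "cat (delta [b]) (left_normed (a # v)) (a # u) = (0 :: 'a)"
    using snoc.prems by (subst cat_delta_Cons) auto
  ultimately have "left_normed (a # v @ [b]) (a # u) = (cat (left_normed (a # v)) (delta [b]) (a # u) :: 'a)"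
    by (simp add: bracket_def)
  then show ?case
    using snoc by (cases u rule: rev_cases) (auto simp: cat_delta_single_right butlast_append)
qed

text \<open>Left-normed brackets of the words with one fixed first letter form a basis of the
  multilinear Lie elements on a letter set; the minimum is a choice of that letter for all letter
  sets at once.\<close>

definition minfirst :: "nat list \<Rightarrow> bool" where
  "minfirst v \<longleftrightarrow> v \<noteq> [] \<and> distinct v \<and> hd v = Min (set v)"

lemma left_normed_minfirst:
  assumes "minfirst s" "minfirst t"
  shows "left_normed s t = (if s = t then 1 else 0)"
proof (cases "set s = set t")
  case True
  then obtain a u v where "s = a # u" "t = a # v"
    using assms by (cases s; cases t) (auto simp: minfirst_def)
  then show ?thesis using left_normed_same_hd[of a u v] assms by (auto simp: minfirst_def)
next
  case False
  then show ?thesis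
    using supported_left_normed[of s] assms by (auto simp: supported_def minfirst_def permutations_of_set_def)
qed

lemma ad_word_lext: "ad_word (\<lambda>z. lext A y (\<lambda>w. F w z)) v z = lext A y (\<lambda>w. ad_word (F w) v z)"
proof (induction v arbitrary: z rule: rev_induct)
  case (snoc a v)
  then have "ad_word (\<lambda>z. lext A y (\<lambda>w. F w z)) v = (\<lambda>z. lext A y (\<lambda>w. ad_word (F w) v z))" by blast
  then show ?case by (simp add: ad_word_append bracket_lext_left)
qed simp

lemma lext_uminus_left: "lext A (\<lambda>w. - y w) g = - lext A y g"
  by (simp add: lext_def sum_negf)

text \<open>By antisymmetry [x, a] = -[a, x], and bracketing with the Lie element of
  \<open>x\<close> is the word-by-word adjoint action on its terms. The trailing letters
  \<open>y\<close> are carried along by linearity.\<close>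

lemma left_normed_move_to_front:
  assumes "distinct (x @ a # y)" "x \<noteq> []"
  shows "left_normed (x @ a # y) z = (lext (set x) (\<lambda>w. - left_normed x w) (\<lambda>w. left_normed (a # w @ y) z) :: 'a::field)"
proof -
  have "bracket (left_normed x) (delta [a]) = (\<lambda>z. lext (set x) (\<lambda>w. - left_normed x w) (\<lambda>w. left_normed (a # w) z) :: 'a)"
  proof
    show "bracket (left_normed x) (delta [a]) z = (lext (set x) (\<lambda>w. - left_normed x w) (\<lambda>w. left_normed (a # w) z) :: 'a)" for z
      using lext_left_normed_ad_word[of x "delta [a] :: 'a comb" z] assms
      by (subst bracket_antisym) (simp add: lext_uminus_left left_normed_Cons)
  qed
  moreover have "left_normed (x @ a # y) = (ad_word (bracket (left_normed x) (delta [a])) y :: 'a comb)"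
    using assms(2) left_normed_append[of "x @ [a]" y] by (simp add: left_normed_snoc)
  ultimately show ?thesis
    by (simp add: ad_word_lext left_normed_Cons ad_word_append)
qed

text \<open>Moving the least letter to the front yields some expansion. Its coefficients are then
  identified by evaluating at \<open>v\<close>, since the brackets of the words in question are dual
  to those words.\<close>

lemma left_normed_expand_minfirst:
  assumes u: "distinct u" "u \<noteq> []"
  shows "left_normed u z = (\<Sum>v | v \<in> permutations_of_set (set u) \<and> minfirst v. left_normed u v * left_normed v z :: 'a::field)"
proof -
  let ?M = "{v \<in> permutations_of_set (set u). minfirst v}"
  have fin: "finite ?M" by simp
  have "\<exists>c. \<forall>z. left_normed u z = (\<Sum>v\<in>?M. c v * left_normed v z :: 'a)"
  proof -
    define a where "a = Min (set u)"
    have a: "a \<in> set u" unfolding a_def using u by (intro Min_in) auto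
    then obtain x y where xy: "u = x @ a # y" by (meson split_list)
    show ?thesis
    proof (cases "x = []")
      case True
      then have "hd u = a" using xy by simp
      then have "u \<in> ?M" using u by (simp add: a_def minfirst_def permutations_of_set_def)
      then have "left_normed u z = (\<Sum>v\<in>?M. (if v = u then 1 else 0) * left_normed v z :: 'a)" for z
        by (simp add: if_distrib[of "\<lambda>c. c * _"] cong: if_cong)
      then show ?thesis by (intro exI[of _ "\<lambda>v. if v = u then 1 else 0"]) blast
    next
      case False
      define c where "c v = (\<Sum>w\<in>permutations_of_set (set x). if v = a # w @ y then - left_normed x w else 0 :: 'a)" for v
      have mem: "a # w @ y \<in> ?M" if "w \<in> permutations_of_set (set x)" for w
      proof -
        have "set (a # w @ y) = set u" "distinct (a # w @ y)"
          using that u xy by (auto simp: permutations_of_set_def)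
        then show ?thesis by (simp add: minfirst_def permutations_of_set_def flip: a_def)
      qed
      have "left_normed u z = (\<Sum>v\<in>?M. c v * left_normed v z)" for z
      proof -
        have "(\<Sum>v\<in>?M. c v * left_normed v z) = (\<Sum>w\<in>permutations_of_set (set x).
            \<Sum>v\<in>?M. if v = a # w @ y then - left_normed x w * left_normed v z else 0)"
          unfolding c_def sum_distrib_right by (subst sum.swap) (intro sum.cong, auto)
        also have "\<dots> = (\<Sum>w\<in>permutations_of_set (set x). - left_normed x w * left_normed (a # w @ y) z)"
          using mem fin by (intro sum.cong refl) (subst sum.delta, auto)
        also have "\<dots> = left_normed u z"
          using u xy False by (simp add: left_normed_move_to_front lext_def)
        finally show ?thesis by simp
      qed
      then show ?thesis by blast
    qed
  qed
  then obtain c :: "nat list \<Rightarrow> 'a" where c: "left_normed u z = (\<Sum>v\<in>?M. c v * left_normed v z)" for z by blast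
  have "left_normed u v = c v" if "v \<in> ?M" for v
  proof -
    have "left_normed u v = (\<Sum>w\<in>?M. if w = v then c w else 0)"
      unfolding c[of v] using that by (intro sum.cong refl) (auto simp: left_normed_minfirst)
    then show ?thesis using that fin by simp
  qed
  then show ?thesis unfolding c[of z] by (intro sum.cong) auto
qed

text \<open>The value of \<open>\<omega>\<^sub>q\<close> on the word \<open>w\<close>, written as a recursion on \<open>q\<close>.\<close>

fun lie_unshuffle :: "nat list \<Rightarrow> nat list \<Rightarrow> 'a::field comb" where
  "lie_unshuffle [] w = delta []"
| "lie_unshuffle (m # q) w = (\<lambda>z. \<Sum>B | B \<subseteq> set w \<and> card B = m.
    cat (left_normed (filter (\<lambda>x. x \<in> B) w)) (lie_unshuffle q (filter (\<lambda>x. x \<notin> B) w)) z)"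

text \<open>The sum over all orders of the blocks in \<open>S\<close> whose lengths spell
  \<open>q\<close>, with the first block chosen at each stage. The unit is returned at the end
  whatever remains of \<open>S\<close>; it is applied to sets with as many blocks as
  \<open>q\<close> has parts.\<close>

fun sym_prod :: "nat list \<Rightarrow> nat list set \<Rightarrow> 'a::field comb" where
  "sym_prod [] S = delta []"
| "sym_prod (m # q) S = (\<lambda>z. \<Sum>t | t \<in> S \<and> length t = m. cat (left_normed t) (sym_prod q (S - {t})) z)"

text \<open>By primitivity, only subsets \<open>B\<close> that are unions of blocks contribute.\<close>

lemma lext_left_normed_prod_lie_unshuffle_Cons:
  fixes Ts :: "nat list list"
  assumes "distinct (concat Ts)"
  defines "inB \<equiv> \<lambda>B. filter (\<lambda>t. set t \<subseteq> B) Ts" and "offB \<equiv> \<lambda>B. filter (\<lambda>t. \<not> set t \<subseteq> B) Ts"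
  shows "lext (set (concat Ts)) (left_normed_prod Ts) (\<lambda>w. lie_unshuffle (m # q) w z) =
    (\<Sum>B | B \<subseteq> set (concat Ts) \<and> card B = m \<and> (\<forall>t\<in>set Ts. set t \<subseteq> B \<or> B \<inter> set t = {}).
      cat (\<lambda>z. lext (set (concat (inB B))) (left_normed_prod (inB B)) (\<lambda>u. left_normed u z))
          (\<lambda>z. lext (set (concat (offB B))) (left_normed_prod (offB B)) (\<lambda>v. lie_unshuffle q v z)) z)"
proof -
  let ?A = "set (concat Ts)"
  let ?f = "\<lambda>B w. cat (left_normed (filter (\<lambda>x. x \<in> B) w)) (lie_unshuffle q (filter (\<lambda>x. x \<notin> B) w)) z"
  have "lext ?A (left_normed_prod Ts) (\<lambda>w. lie_unshuffle (m # q) w z) = lext ?A (left_normed_prod Ts) (\<lambda>w. \<Sum>B | B \<subseteq> ?A \<and> card B = m. ?f B w)"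
    by (intro lext_cong) (simp add: permutations_of_set_def)
  also have "\<dots> = (\<Sum>B | B \<subseteq> ?A \<and> card B = m. lext ?A (left_normed_prod Ts) (?f B))"
    by (rule lext_sum)
  also have "\<dots> = (\<Sum>B | B \<subseteq> ?A \<and> card B = m.
    if \<forall>t\<in>set Ts. set t \<subseteq> B \<or> B \<inter> set t = {} then
     lext (set (concat (inB B))) (left_normed_prod (inB B))
       (\<lambda>u. lext (set (concat (offB B))) (left_normed_prod (offB B)) (\<lambda>v. cat (left_normed u) (lie_unshuffle q v) z)) else 0)"
    by (intro sum.cong refl) (simp only: lext_left_normed_prod_split[OF assms(1), of "\<lambda>u v. cat (left_normed u) (lie_unshuffle q v) z"] inB_def offB_def)
  also have "\<dots> = (\<Sum>B\<in>{B \<in> {B. B \<subseteq> ?A \<and> card B = m}. (\<forall>t\<in>set Ts. set t \<subseteq> B \<or> B \<inter> set t = {})}.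
     lext (set (concat (inB B))) (left_normed_prod (inB B))
       (\<lambda>u. lext (set (concat (offB B))) (left_normed_prod (offB B)) (\<lambda>v. cat (left_normed u) (lie_unshuffle q v) z)))"
    by (rule sum.inter_filter[symmetric]) (rule finite_subset[of _ "Pow ?A"], auto)
  finally show ?thesis
    by (simp add: cat_lext_left cat_lext_right conj_assoc)
qed

text \<open>Each positive part consumes at least one whole block, so the blocks run out before the
  parts do.\<close>

lemma lext_left_normed_prod_lie_unshuffle_short:
  assumes "distinct (concat Ts)" "[] \<notin> set Ts" "0 \<notin> set q" "length Ts < length q"
  shows "lext (set (concat Ts)) (left_normed_prod Ts) (\<lambda>w. lie_unshuffle q w z) = (0 :: 'a::field)"
  using assms
proof (induction q arbitrary: Ts z)
  case (Cons m q)
  show ?case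
    unfolding lext_left_normed_prod_lie_unshuffle_Cons[OF Cons.prems(1)]
  proof (rule sum.neutral, rule ballI, goal_cases)
    case (1 B)
    let ?off = "filter (\<lambda>t. \<not> set t \<subseteq> B) Ts"
    have "B \<noteq> {}" using 1 Cons.prems(3) by auto
    then obtain t where "t \<in> set Ts" "set t \<subseteq> B" using 1 by auto blast
    then have "length ?off < length Ts" by (auto intro: length_filter_less)
    then have "lext (set (concat ?off)) (left_normed_prod ?off) (\<lambda>v. lie_unshuffle q v z) = (0 :: 'a)" for z
      using Cons.prems by (intro Cons.IH) (auto simp: distinct_concat_filter)
    then show ?case by simp
  qed
qed simp

text \<open>A set \<open>B\<close> swallowing two blocks leaves fewer blocks than remaining parts
  and contributes 0. Hence \<open>B\<close> is the letter set of a single block of length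
  \<open>m\<close>, and the Dynkin identity yields a factor \<open>m\<close> for it; these factors
  make up \<open>prod_list q\<close>.\<close>

lemma lext_left_normed_prod_lie_unshuffle:
  assumes "distinct (concat Ts)" "[] \<notin> set Ts" "0 \<notin> set q" "length Ts = length q"
  shows "lext (set (concat Ts)) (left_normed_prod Ts) (\<lambda>w. lie_unshuffle q w z) = of_nat (prod_list q) * (sym_prod q (set Ts) z :: 'a::field)"
  using assms
proof (induction q arbitrary: Ts z)
  case Nil
  then show ?case by (simp add: lext_delta[of "[]"])
next
  case (Cons m q)
  let ?in = "\<lambda>B. filter (\<lambda>t. set t \<subseteq> B) Ts" and ?off = "\<lambda>B. filter (\<lambda>t. \<not> set t \<subseteq> B) Ts"
  let ?g = "\<lambda>B. cat (\<lambda>z. lext (set (concat (?in B))) (left_normed_prod (?in B)) (\<lambda>u. left_normed u z))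
          (\<lambda>z. lext (set (concat (?off B))) (left_normed_prod (?off B)) (\<lambda>v. lie_unshuffle q v z)) z :: 'a"
  let ?C = "{B. B \<subseteq> set (concat Ts) \<and> card B = m \<and> (\<forall>t\<in>set Ts. set t \<subseteq> B \<or> B \<inter> set t = {})}"
  let ?S = "{t \<in> set Ts. length t = m}"
  have dT: "distinct Ts" using Cons.prems(1,2) by (simp add: distinct_concat_iff removeAll_id)
  have dis: "distinct t" if "t \<in> set Ts" for t using Cons.prems(1) that by (simp add: distinct_concat_iff)
  have disj: "set s \<inter> set t = {}" if "s \<in> set Ts" "t \<in> set Ts" "s \<noteq> t" for s t
    using Cons.prems(1) that by (simp add: distinct_concat_iff)
  have ne: "t \<noteq> []" if "t \<in> set Ts" for t using Cons.prems that by auto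
  have sub: "set ` ?S \<subseteq> ?C"
    using disj dis by (fastforce simp: distinct_card)
  have inj: "inj_on set ?S"
    using disj ne by (fastforce simp: inj_on_def)
  have zero: "?g B = 0" if B: "B \<in> ?C - set ` ?S" for B
  proof -
    have "\<exists>s\<in>set Ts. \<exists>t\<in>set Ts. s \<noteq> t \<and> set s \<subseteq> B \<and> set t \<subseteq> B"
    proof -
      have "B \<noteq> {}" using B Cons.prems(3) by auto
      then obtain s where s: "s \<in> set Ts" "set s \<subseteq> B" using B by auto blast
      have "B \<noteq> set s" using B s dis[OF s(1)] by (auto simp: distinct_card)
      then obtain b where b: "b \<in> B" "b \<notin> set s" using s by auto
      then obtain t where t: "t \<in> set Ts" "b \<in> set t" using B by auto
      have "set t \<subseteq> B \<or> B \<inter> set t = {}" using B t by simp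
      then have "set t \<subseteq> B" using b t by blast
      then show ?thesis using s b t by metis
    qed
    then obtain s t where st: "s \<in> set Ts" "t \<in> set Ts" "s \<noteq> t" "set s \<subseteq> B" "set t \<subseteq> B" by blast
    have "card {s, t} \<le> card (set Ts - set (?off B))"
      using st by (intro card_mono) auto
    also have "\<dots> = length Ts - length (?off B)"
      using dT distinct_card[of "?off B"] by (simp add: card_Diff_subset distinct_card)
    finally have "length (?off B) < length q" using st Cons.prems by auto
    then have "lext (set (concat (?off B))) (left_normed_prod (?off B)) (\<lambda>v. lie_unshuffle q v z) = (0 :: 'a)" for z
      using Cons.prems by (intro lext_left_normed_prod_lie_unshuffle_short) (auto simp: distinct_concat_filter)
    then show ?thesis by simp
  qed
  have val: "?g (set t) = of_nat (prod_list (m # q)) * cat (left_normed t) (sym_prod q (set Ts - {t})) z" if "t \<in> ?S" for t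
  proof -
    have t: "t \<in> set Ts" "length t = m" using that by auto
    have iff: "set s \<subseteq> set t \<longleftrightarrow> s = t" if "s \<in> set Ts" for s
      using disj[OF that t(1)] ne[OF that] by (cases s) auto
    have "?in (set t) = filter (\<lambda>s. s = t) Ts" "?off (set t) = filter (\<lambda>s. s \<noteq> t) Ts"
      using iff by (auto intro: filter_cong)
    moreover have "filter (\<lambda>s. s = t) Ts = [t]"
      using dT t by (induction Ts) (auto simp: filter_empty_conv)
    ultimately have in_eq: "?in (set t) = [t]" and off_eq: "?off (set t) = filter (\<lambda>s. s \<noteq> t) Ts" by auto
    have set_off: "set (?off (set t)) = set Ts - {t}" unfolding off_eq by auto
    have "length (?off (set t)) = card (set Ts - {t})"
      using dT set_off by (metis distinct_card distinct_filter)
    then have len: "length (?off (set t)) = length q"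
      using dT t Cons.prems by (simp add: distinct_card)
    have "(\<lambda>z. lext (set (concat (?off (set t)))) (left_normed_prod (?off (set t))) (\<lambda>v. lie_unshuffle q v z))
        = (\<lambda>z. of_nat (prod_list q) * sym_prod q (set Ts - {t}) z :: 'a)"
      using Cons.prems len set_off
      by (intro ext, subst Cons.IH) (auto simp: distinct_concat_filter)
    moreover have "(\<lambda>z. lext (set (concat (?in (set t)))) (left_normed_prod (?in (set t))) (\<lambda>u. left_normed u z))
        = (\<lambda>z. of_nat m * left_normed t z :: 'a)"
      using dynkin[of t] t ne dis by (auto simp: in_eq)
    ultimately show ?thesis
      by (simp add: cat_mult_left cat_mult_right)
  qed
  have "finite ?C" by (rule finite_subset[of _ "Pow (set (concat Ts))"]) auto
  then have "sum ?g ?C = sum ?g (set ` ?S)"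
    using sub zero by (intro sum.mono_neutral_right) auto
  also have "\<dots> = (\<Sum>t\<in>?S. ?g (set t))"
    by (subst sum.reindex[OF inj]) simp
  also have "\<dots> = (\<Sum>t\<in>?S. of_nat (prod_list (m # q)) * cat (left_normed t) (sym_prod q (set Ts - {t})) z)"
    by (intro sum.cong refl val)
  also have "\<dots> = of_nat (prod_list (m # q)) * sym_prod (m # q) (set Ts) z"
    by (simp add: sum_distrib_left)
  finally show ?case
    unfolding lext_left_normed_prod_lie_unshuffle_Cons[OF Cons.prems(1)] .
qed

section \<open>Sets of words starting with their minimum\<close>

text \<open>An unordered version of \<open>\<Gamma>(\<lambda>(q))\<close>: the order of the blocks carries no information.\<close>

definition word_partitions :: "nat set \<Rightarrow> nat list \<Rightarrow> nat list set set" where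
  "word_partitions A q = {S. finite S \<and> (\<forall>t\<in>S. minfirst t) \<and> (\<forall>s\<in>S. \<forall>t\<in>S. s \<noteq> t \<longrightarrow> set s \<inter> set t = {}) \<and>
     (\<Union>t\<in>S. set t) = A \<and> image_mset length (mset_set S) = mset q}"

lemma word_partitions_Nil [simp]: "word_partitions {} [] = {{}}"
  by (auto simp: word_partitions_def mset_set_empty_iff)

lemma finite_word_partitions: "finite A \<Longrightarrow> finite (word_partitions A q)"
proof -
  assume "finite A"
  then have "finite (Pow {xs. set xs \<subseteq> A \<and> distinct xs})"
    by (simp add: finite_subset_distinct)
  then show ?thesis
    by (rule rev_finite_subset) (auto simp: word_partitions_def minfirst_def)
qed

lemma word_partitions_insert:
  assumes t: "minfirst t" "set t \<subseteq> A" and S: "S \<in> word_partitions (A - set t) q"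
  shows "t \<notin> S" "insert t S \<in> word_partitions A (length t # q)"
proof -
  show "t \<notin> S"
  proof
    assume "t \<in> S"
    then have "set t \<subseteq> A - set t" using S by (auto simp: word_partitions_def)
    then show False using t by (cases t) (auto simp: minfirst_def)
  qed
  then show "insert t S \<in> word_partitions A (length t # q)"
    using t S unfolding word_partitions_def by (auto 4 3)
qed

lemma word_partitions_remove:
  assumes "S \<in> word_partitions A (length t # q)" "t \<in> S"
  shows "minfirst t" "set t \<subseteq> A" "S - {t} \<in> word_partitions (A - set t) q"
proof -
  show "minfirst t" "set t \<subseteq> A" using assms by (auto simp: word_partitions_def)
  have "mset_set S = add_mset t (mset_set (S - {t}))"
    using assms by (simp add: word_partitions_def mset_set.remove)
  then have "image_mset length (mset_set (S - {t})) = mset q"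
    using assms by (simp add: word_partitions_def)
  moreover have "(\<Union>s\<in>S - {t}. set s) = A - set t"
    using assms by (auto simp: word_partitions_def)
  ultimately show "S - {t} \<in> word_partitions (A - set t) q"
    using assms by (simp add: word_partitions_def)
qed

text \<open>Double counting of pairs of a partition and a marked block of length \<open>m\<close>.
  Both the enumeration and the spanning argument run their recursion on \<open>q\<close> through
  it.\<close>

lemma sum_word_partitions_Cons:
  fixes f :: "nat list \<Rightarrow> nat list set \<Rightarrow> 'b::comm_monoid_add"
  assumes "finite A"
  shows "(\<Sum>S\<in>word_partitions A (m # q). \<Sum>t | t \<in> S \<and> length t = m. f t (S - {t})) =
    (\<Sum>t | minfirst t \<and> set t \<subseteq> A \<and> length t = m. \<Sum>S\<in>word_partitions (A - set t) q. f t S)"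
proof -
  have fin: "finite {t. minfirst t \<and> set t \<subseteq> A \<and> length t = m}"
    by (rule finite_subset[OF _ finite_subset_distinct[OF assms]]) (auto simp: minfirst_def)
  have "(\<Sum>S\<in>word_partitions A (m # q). \<Sum>t | t \<in> S \<and> length t = m. f t (S - {t})) =
      (\<Sum>(S, t)\<in>(SIGMA S:word_partitions A (m # q). {t. t \<in> S \<and> length t = m}). f t (S - {t}))"
    by (intro sum.Sigma finite_word_partitions[OF assms]) (auto simp: word_partitions_def)
  also have "\<dots> = (\<Sum>(t, S)\<in>(SIGMA t:{t. minfirst t \<and> set t \<subseteq> A \<and> length t = m}. word_partitions (A - set t) q). f t S)"
    by (rule sum.reindex_bij_witness[where i = "\<lambda>(t, S). (insert t S, t)" and j = "\<lambda>(S, t). (t, S - {t})"])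
      (auto dest: word_partitions_insert word_partitions_remove)
  also have "\<dots> = (\<Sum>t | minfirst t \<and> set t \<subseteq> A \<and> length t = m. \<Sum>S\<in>word_partitions (A - set t) q. f t S)"
    using fin finite_word_partitions assms by (intro sum.Sigma[symmetric]) auto
  finally show ?thesis .
qed

lemma sum_minfirst_by_set:
  fixes f :: "nat list \<Rightarrow> 'b::comm_monoid_add"
  assumes "finite A"
  shows "(\<Sum>t | minfirst t \<and> set t \<subseteq> A \<and> length t = m. f t) =
    (\<Sum>B | B \<subseteq> A \<and> card B = m. \<Sum>t | t \<in> permutations_of_set B \<and> minfirst t. f t)"
proof -
  have fin: "finite {B. B \<subseteq> A \<and> card B = m}"
    by (rule finite_subset[of _ "Pow A"]) (use assms in auto)
  have "(\<Sum>B | B \<subseteq> A \<and> card B = m. \<Sum>t | t \<in> permutations_of_set B \<and> minfirst t. f t) =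
    (\<Sum>(B, t)\<in>(SIGMA B:{B. B \<subseteq> A \<and> card B = m}. {t. t \<in> permutations_of_set B \<and> minfirst t}). f t)"
    using fin by (intro sum.Sigma) auto
  also have "\<dots> = (\<Sum>t | minfirst t \<and> set t \<subseteq> A \<and> length t = m. f t)"
    by (rule sum.reindex_bij_witness[where i = "\<lambda>t. (set t, t)" and j = snd])
      (auto simp: permutations_of_set_def minfirst_def distinct_card)
  finally show ?thesis by simp
qed

lemma card_minfirst:
  assumes "finite B" "B \<noteq> {}"
  shows "card {t \<in> permutations_of_set B. minfirst t} = fact (card B - 1)"
proof -
  have "{t \<in> permutations_of_set B. minfirst t} = (#) (Min B) ` permutations_of_set (B - {Min B})"
  proof (intro set_eqI iffI)
    fix t assume t: "t \<in> {t \<in> permutations_of_set B. minfirst t}"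
    then obtain u where "t = Min B # u"
      by (cases t) (auto simp: minfirst_def permutations_of_set_def)
    then show "t \<in> (#) (Min B) ` permutations_of_set (B - {Min B})"
      using t by (auto simp: permutations_of_set_def)
  next
    fix t assume "t \<in> (#) (Min B) ` permutations_of_set (B - {Min B})"
    then obtain u where u: "t = Min B # u" "set u = B - {Min B}" "distinct u"
      by (auto simp: permutations_of_set_def)
    moreover have "set t = B" using u Min_in[OF assms] by auto
    ultimately show "t \<in> {t \<in> permutations_of_set B. minfirst t}"
      by (simp add: minfirst_def permutations_of_set_def)
  qed
  moreover have "card ((#) (Min B) ` permutations_of_set (B - {Min B})) = card (permutations_of_set (B - {Min B}))"
    by (rule card_image) (simp add: inj_on_def)
  ultimately show ?thesis using assms by simp
qed

text \<open>A value that is not a part contributes the factor 1, so \<open>q\<close> and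
  \<open>m # q\<close> can be compared over the same index set.\<close>

lemma qq_superset:
  assumes "finite I" "set q \<subseteq> I"
  shows "qq q = (\<Prod>i\<in>I. i ^ count_list q i * fact (count_list q i))"
  unfolding qq_def by (rule prod.mono_neutral_left) (use assms in auto)

lemma qq_Cons: "qq (m # q) = qq q * m * Suc (count_list q m)"
proof -
  let ?I = "insert m (set q)"
  have "qq (m # q) = (\<Prod>i\<in>?I. i ^ count_list (m # q) i * fact (count_list (m # q) i))"
    by (rule qq_superset) auto
  also have "\<dots> = m ^ count_list (m # q) m * fact (count_list (m # q) m) *
     (\<Prod>i\<in>?I - {m}. i ^ count_list (m # q) i * fact (count_list (m # q) i))"
    by (rule prod.remove) auto
  also have "(\<Prod>i\<in>?I - {m}. i ^ count_list (m # q) i * fact (count_list (m # q) i)) =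
     (\<Prod>i\<in>?I - {m}. i ^ count_list q i * fact (count_list q i))"
    by (rule prod.cong) auto
  also have "m ^ count_list (m # q) m * fact (count_list (m # q) m) * \<dots> =
     (m ^ count_list q m * fact (count_list q m) * \<dots>) * (m * Suc (count_list q m))"
    by (simp add: algebra_simps)
  also have "m ^ count_list q m * fact (count_list q m) * (\<Prod>i\<in>?I - {m}. i ^ count_list q i * fact (count_list q i)) = qq q"
    using qq_superset[of ?I q] prod.remove[of ?I m "\<lambda>i. i ^ count_list q i * fact (count_list q i)"]
    by (simp add: subset_insertI)
  finally show ?thesis by (simp only: mult.assoc)
qed

text \<open>Mark one of the \<open>Suc (count_list q m)\<close> blocks of length \<open>m\<close>.
  It has \<open>card A choose m\<close> possible letter sets and \<open>fact (m - 1)\<close>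
  possible orders, and the rest is counted by induction. The two new factors in
  \<open>qq_Cons\<close> account for the marking and complete \<open>fact (m - 1)\<close> to
  \<open>fact m\<close>. The multiplicative form spares a divisibility argument.\<close>

lemma card_word_partitions:
  assumes "finite A" "0 \<notin> set q" "sum_list q = card A"
  shows "card (word_partitions A q) * qq q = fact (card A)"
  using assms
proof (induction q arbitrary: A)
  case Nil
  then show ?case by (simp add: qq_def)
next
  case (Cons m q)
  let ?k = "Suc (count_list q m)" and ?n = "card A"
  have m: "m > 0" "m \<le> ?n" using Cons.prems by auto
  have len: "card {t \<in> S. length t = m} = ?k" if "S \<in> word_partitions A (m # q)" for S
  proof -
    have S: "finite S" "image_mset length (mset_set S) = mset (m # q)" using that by (auto simp: word_partitions_def)
    have "count (image_mset length (mset_set S)) m = card {t \<in> S. length t = m}"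
      using S(1) by (auto simp: count_image_mset intro!: arg_cong[of _ _ card])
    then show ?thesis using S by (simp add: count_mset)
  qed
  have "card (word_partitions A (m # q)) * ?k = (\<Sum>S\<in>word_partitions A (m # q). \<Sum>t | t \<in> S \<and> length t = m. 1)"
    using len by simp
  also have "\<dots> = (\<Sum>t | minfirst t \<and> set t \<subseteq> A \<and> length t = m. \<Sum>S\<in>word_partitions (A - set t) q. 1)"
    by (rule sum_word_partitions_Cons[OF Cons.prems(1)])
  also have "\<dots> = (\<Sum>B | B \<subseteq> A \<and> card B = m. \<Sum>t | t \<in> permutations_of_set B \<and> minfirst t. card (word_partitions (A - set t) q))"
    by (subst sum_minfirst_by_set[OF Cons.prems(1)]) simp
  finally have "card (word_partitions A (m # q)) * ?k * (qq q * m) =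
    (\<Sum>B | B \<subseteq> A \<and> card B = m. \<Sum>t | t \<in> permutations_of_set B \<and> minfirst t. card (word_partitions (A - set t) q) * qq q * m)"
    by (simp add: sum_distrib_right mult.assoc)
  also have "\<dots> = (\<Sum>B | B \<subseteq> A \<and> card B = m. \<Sum>t | t \<in> permutations_of_set B \<and> minfirst t. fact (?n - m) * m)"
  proof (intro sum.cong refl, goal_cases)
    case (1 B t)
    then have "set t \<subseteq> A" "card (set t) = m" by (auto simp: permutations_of_set_def)
    then have "card (A - set t) = ?n - m" using Cons.prems(1) by (simp add: card_Diff_subset)
    then show ?case using Cons.IH[of "A - set t"] Cons.prems by simp
  qed
  also have "\<dots> = (\<Sum>B | B \<subseteq> A \<and> card B = m. fact (m - 1) * (fact (?n - m) * m))"
  proof (intro sum.cong refl, goal_cases)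
    case (1 B)
    then have "finite B" "B \<noteq> {}" "card B = m" using m Cons.prems(1) finite_subset by auto
    then show ?case using card_minfirst[of B] by simp
  qed
  also have "\<dots> = (?n choose m) * (fact (m - 1) * m * fact (?n - m))"
    using n_subsets[OF Cons.prems(1), of m] by (simp add: ac_simps)
  also have "\<dots> = fact ?n"
    using binomial_fact_lemma[OF m(2)] m(1) by (simp add: fact_reduce ac_simps)
  finally show ?case by (simp add: qq_Cons algebra_simps)
qed

text \<open>The lengths force the place of every cut in \<open>concat ts\<close>, and at each cut
  the duality of brackets and words forces the factor to be the bracket of the corresponding entry
  of \<open>ts\<close>. So at most one order of one block set contributes.\<close>

lemma sym_prod_coefficient:
  assumes "finite S" "card S = length q" "\<forall>s\<in>S. minfirst s"
    "map length ts = q" "\<forall>t\<in>set ts. minfirst t" "distinct ts"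
  shows "sym_prod q S (concat ts) = (if S = set ts then 1 else 0 :: 'a::field)"
  using assms
proof (induction q arbitrary: S ts)
  case Nil
  then show ?case by simp
next
  case (Cons m q)
  then obtain t us where ts: "ts = t # us" "length t = m" "map length us = q" by (cases ts) auto
  have mf: "minfirst t" "t \<notin> set us" using Cons.prems ts by auto
  have "sym_prod (m # q) S (concat ts) = (\<Sum>s | s \<in> S \<and> length s = m. cat (left_normed s) (sym_prod q (S - {s})) (t @ concat us) :: 'a)"
    by (simp add: ts)
  also have "\<dots> = (\<Sum>s | s \<in> S \<and> length s = m. if s = t then sym_prod q (S - {t}) (concat us) else 0)"
  proof (intro sum.cong refl, goal_cases)
    case (1 s)
    then have s: "minfirst s" "length s = m" using Cons.prems by auto
    then have "cat (left_normed s) (sym_prod q (S - {s})) (t @ concat us) = left_normed s t * (sym_prod q (S - {s}) (concat us) :: 'a)"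
      using supported_length[OF supported_left_normed[of s]] ts(2)
      by (intro cat_length_left[where m = m]) (auto simp: minfirst_def distinct_card)
    then show ?case by (simp add: left_normed_minfirst[OF s(1) mf(1)])
  qed
  also have "\<dots> = (if t \<in> S then sym_prod q (S - {t}) (concat us) else 0)"
    using Cons.prems(1) ts by simp
  also have "\<dots> = (if S = set ts then 1 else 0)"
  proof (cases "t \<in> S")
    case True
    have "sym_prod q (S - {t}) (concat us) = (if S - {t} = set us then 1 else 0 :: 'a)"
      using Cons.prems ts True by (intro Cons.IH) auto
    moreover have "S - {t} = set us \<longleftrightarrow> S = set ts" using True mf ts by auto
    ultimately show ?thesis using True by simp
  qed (auto simp: ts)
  finally show ?case .
qed

text \<open>Choosing a letter set and then a basis word on it amounts to choosing a block. The
  coefficient of a block depends only on the subword of \<open>w\<close> on its letters, not on the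
  slot that receives it, so all orders of a set of blocks share one coefficient and assemble into
  \<open>sym_prod\<close>.\<close>

lemma lie_unshuffle_expand:
  assumes "distinct w" "0 \<notin> set q" "sum_list q = length w"
  shows "lie_unshuffle q w z = (\<Sum>S\<in>word_partitions (set w) q.
    (\<Prod>v\<in>S. left_normed (filter (\<lambda>x. x \<in> set v) w) v) * sym_prod q S z :: 'a::field)"
  using assms
proof (induction q arbitrary: w z)
  case Nil
  then show ?case by simp
next
  case (Cons m q)
  let ?A = "set w"
  define c :: "nat list \<Rightarrow> nat list \<Rightarrow> 'a" where "c w v = left_normed (filter (\<lambda>x. x \<in> set v) w) v" for w v
  let ?M = "\<lambda>B. {t. t \<in> permutations_of_set B \<and> minfirst t}"
  let ?i = "\<lambda>B. filter (\<lambda>x. x \<in> B) w" and ?o = "\<lambda>B. filter (\<lambda>x. x \<notin> B) w"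
  have "lie_unshuffle (m # q) w z = (\<Sum>B | B \<subseteq> ?A \<and> card B = m. cat (left_normed (?i B)) (lie_unshuffle q (?o B)) z :: 'a)"
    by simp
  also have "\<dots> = (\<Sum>B | B \<subseteq> ?A \<and> card B = m. \<Sum>t\<in>?M B. \<Sum>S\<in>word_partitions (?A - set t) q.
      (\<Prod>v\<in>insert t S. c w v) * cat (left_normed t) (sym_prod q S) z)"
  proof (intro sum.cong refl, goal_cases)
    case (1 B)
    then have B: "B \<subseteq> ?A" "card B = m" "finite B" using finite_subset by auto
    have set_i: "set (?i B) = B" and set_o: "set (?o B) = ?A - B" using B by auto
    have "B \<noteq> {}" using Cons.prems B by auto
    then have ne: "?i B \<noteq> []" using set_i by (metis set_empty)
    have i: "left_normed (?i B) = (\<lambda>z. \<Sum>t\<in>?M B. left_normed (?i B) t * left_normed t z :: 'a)"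
      by (rule ext, rule left_normed_expand_minfirst[OF distinct_filter[OF Cons.prems(1)] ne, unfolded set_i])
    have "length (?o B) = card (?A - B)"
      using Cons.prems(1) set_o by (metis distinct_card distinct_filter)
    also have "\<dots> = sum_list q"
      using B Cons.prems by (simp add: card_Diff_subset distinct_card)
    finally have o: "lie_unshuffle q (?o B) = (\<lambda>z. \<Sum>S\<in>word_partitions (?A - B) q. (\<Prod>v\<in>S. c (?o B) v) * sym_prod q S z :: 'a)"
      using Cons.IH[of "?o B"] Cons.prems set_o by (intro ext) (simp add: c_def)
    have "cat (left_normed (?i B)) (lie_unshuffle q (?o B)) z =
      (\<Sum>t\<in>?M B. \<Sum>S\<in>word_partitions (?A - B) q. left_normed (?i B) t * ((\<Prod>v\<in>S. c (?o B) v) * cat (left_normed t) (sym_prod q S) z))"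
      by (subst i, subst o) (simp only: cat_sum_left cat_sum_right cat_mult_left cat_mult_right sum_distrib_left)
    also have "\<dots> = (\<Sum>t\<in>?M B. \<Sum>S\<in>word_partitions (?A - set t) q.
      (\<Prod>v\<in>insert t S. c w v) * cat (left_normed t) (sym_prod q S) z)"
    proof (rule sum.cong[OF refl])
      fix t assume "t \<in> ?M B"
      then have t: "set t = B" "minfirst t" by (auto simp: permutations_of_set_def)
      show "(\<Sum>S\<in>word_partitions (?A - B) q. left_normed (?i B) t * ((\<Prod>v\<in>S. c (?o B) v) * cat (left_normed t) (sym_prod q S) z)) =
        (\<Sum>S\<in>word_partitions (?A - set t) q. (\<Prod>v\<in>insert t S. c w v) * cat (left_normed t) (sym_prod q S) z)"
        unfolding t(1)
      proof (rule sum.cong[OF refl])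
        fix S assume S: "S \<in> word_partitions (?A - B) q"
        then have "t \<notin> S" "finite S" using word_partitions_insert(1)[of t ?A S q] t B by (auto simp: word_partitions_def)
        \<comment> \<open>The letters of \<open>v\<close> avoid \<open>B\<close>, so deleting
          \<open>B\<close> from \<open>w\<close> beforehand does not change the subword on
          them.\<close>
        moreover have "c (?o B) v = c w v" if "v \<in> S" for v
        proof -
          have "set v \<subseteq> ?A - B" using S that by (auto simp: word_partitions_def)
          then show ?thesis unfolding c_def filter_filter
            by (intro arg_cong[of _ _ "\<lambda>u. left_normed u v"] filter_cong) auto
        qed
        moreover have "c w t = left_normed (?i B) t" by (simp add: c_def t)
        ultimately show "left_normed (?i B) t * ((\<Prod>v\<in>S. c (?o B) v) * cat (left_normed t) (sym_prod q S) z) =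
          (\<Prod>v\<in>insert t S. c w v) * cat (left_normed t) (sym_prod q S) z"
          by simp
      qed
    qed
    finally show ?case .
  qed
  also have "\<dots> = (\<Sum>t | minfirst t \<and> set t \<subseteq> ?A \<and> length t = m. \<Sum>S\<in>word_partitions (?A - set t) q.
      (\<Prod>v\<in>insert t S. c w v) * cat (left_normed t) (sym_prod q S) z)"
    by (rule sum_minfirst_by_set[symmetric]) simp
  also have "\<dots> = (\<Sum>S\<in>word_partitions ?A (m # q). \<Sum>t | t \<in> S \<and> length t = m.
      (\<Prod>v\<in>insert t (S - {t}). c w v) * cat (left_normed t) (sym_prod q (S - {t})) z)"
    by (rule sum_word_partitions_Cons[symmetric]) simp
  also have "\<dots> = (\<Sum>S\<in>word_partitions ?A (m # q). (\<Prod>v\<in>S. c w v) * sym_prod (m # q) S z)"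
    by (intro sum.cong refl) (auto simp: sum_distrib_left insert_absorb intro!: sum.cong)
  finally show ?case by (simp only: c_def)
qed

section \<open>The group algebra acting on words\<close>

lemma act_alt: "act n x w u = (\<Sum>t\<in>perms n. if perm_mult t w = u then x t else 0)"
  by (simp add: act_def perm_mult_def)

lemma length_perms: "t \<in> perms n \<Longrightarrow> length t = n"
  unfolding perms_eq using length_finite_permutations_of_set by fastforce

lemma finite_perms [simp]: "finite (perms n)"
  by (simp add: perms_eq)

lemma map_nth_upt:
  assumes "b \<le> length w"
  shows "map (\<lambda>j. w ! (j - 1)) [a + 1..<b + 1] = take (b - a) (drop a w)"
  by (rule nth_equalityI) (use assms in \<open>auto simp del: upt_Suc\<close>)

lemma perm_mult_bij:
  assumes "distinct w" "length w = n"
  shows "bij_betw (\<lambda>t. perm_mult t w) (perms n) (permutations_of_set (set w))"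
proof -
  let ?f = "\<lambda>j. w ! (j - 1)"
  have inj: "inj_on ?f {1..n}"
    using assms by (auto simp: inj_on_def nth_eq_iff_index_eq)
  have im: "?f ` {1..n} = set w"
  proof -
    have "?f ` {1..n} = set (map ?f [0 + 1..<n + 1])" by (simp add: atLeastLessThanSuc_atLeastAtMost del: upt_Suc)
    also have "map ?f [0 + 1..<n + 1] = w" using assms by (subst map_nth_upt) auto
    finally show ?thesis .
  qed
  have "inj_on (map ?f) (perms n)"
    by (rule inj_on_mapI) (rule inj_on_subset[OF inj], auto simp: perms_def)
  moreover have "map ?f ` perms n = permutations_of_set (set w)"
    unfolding perms_eq im[symmetric] by (rule permutations_of_set_image_inj[OF inj, symmetric])
  ultimately show ?thesis
    unfolding bij_betw_def perm_mult_def by simp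
qed

lemma perm_mult_in_perms:
  assumes "u \<in> perms n" "v \<in> perms n"
  shows "perm_mult u v \<in> perms n"
  using bij_betwE[OF perm_mult_bij[of v n]] assms length_perms[OF assms(2)]
  by (auto simp: perms_eq permutations_of_set_def)

lemma perm_mult_assoc:
  assumes "u \<in> perms n" "v \<in> perms n"
  shows "perm_mult (perm_mult u v) w = perm_mult u (perm_mult v w)"
proof -
  have "j - 1 < length v" if "j \<in> set u" for j
    using that assms length_perms[OF assms(2)] by (auto simp: perms_def)
  then show ?thesis by (auto simp: perm_mult_def)
qed

lemma act_perm_mult:
  assumes "distinct w" "length w = n" "t \<in> perms n"
  shows "act n x w (perm_mult t w) = x t"
proof -
  have "inj_on (\<lambda>t. perm_mult t w) (perms n)"
    using perm_mult_bij[OF assms(1,2)] by (simp add: bij_betw_def)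
  then have "act n x w (perm_mult t w) = (\<Sum>s\<in>perms n. if s = t then x s else 0)"
    unfolding act_alt by (intro sum.cong refl) (use assms(3) in \<open>auto dest: inj_onD\<close>)
  then show ?thesis using assms(3) by simp
qed

lemma supported_act:
  assumes "distinct w" "length w = n"
  shows "supported (set w) (act n x w)"
  unfolding supported_def act_alt
  using bij_betwE[OF perm_mult_bij[OF assms]] by (auto intro!: sum.neutral)

lemma lext_act:
  assumes "distinct w" "length w = n"
  shows "lext (set w) (act n x w) g = (\<Sum>t\<in>perms n. x t * g (perm_mult t w))"
  unfolding lext_def
  by (subst sum.reindex_bij_betw[OF perm_mult_bij[OF assms], symmetric])
    (simp add: act_perm_mult[OF assms])

text \<open>The bridge from the group algebra to words: left multiplication by \<open>x\<close> is
  the linear extension of the place action of \<open>x\<close>.\<close>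

lemma conv_act: "conv n x y z = (\<Sum>v\<in>perms n. y v * act n x v z)"
  unfolding conv_def act_alt
  by (subst sum.swap) (auto simp: sum_distrib_left intro!: sum.cong)

text \<open>The place action is a left action, so the right factor acts first. Inductions over
  \<open>prodl\<close> therefore begin at the end of the list of factors.\<close>

lemma act_conv:
  assumes "distinct w" "length w = n"
  shows "act n (conv n x y) w z = lext (set w) (act n y w) (\<lambda>u. act n x u z)"
proof -
  have "act n (conv n x y) w z = (\<Sum>t\<in>perms n. \<Sum>v\<in>perms n. \<Sum>u\<in>perms n.
      if perm_mult u v = t then (if perm_mult t w = z then y v * x u else 0) else 0)"
    unfolding act_alt conv_act by (auto simp: sum_distrib_left intro!: sum.cong sum.neutral)
  also have "\<dots> = (\<Sum>v\<in>perms n. \<Sum>u\<in>perms n. \<Sum>t\<in>perms n.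
      if perm_mult u v = t then (if perm_mult t w = z then y v * x u else 0) else 0)"
    by (subst sum.swap, rule sum.cong[OF refl], rule sum.swap)
  also have "\<dots> = (\<Sum>v\<in>perms n. \<Sum>u\<in>perms n. if perm_mult u (perm_mult v w) = z then y v * x u else 0)"
    by (intro sum.cong refl) (simp add: perm_mult_in_perms perm_mult_assoc)
  also have "\<dots> = lext (set w) (act n y w) (\<lambda>u. act n x u z)"
    unfolding lext_act[OF assms] act_alt by (auto simp: sum_distrib_left intro!: sum.cong)
  finally show ?thesis .
qed

lemma act_delta:
  assumes "t \<in> perms n"
  shows "act n (delta t) w z = delta (perm_mult t w) z"
proof -
  have "act n (delta t) w z = (\<Sum>s\<in>perms n. if s = t then delta (perm_mult t w) z else 0)"
    unfolding act_alt by (intro sum.cong refl) (auto simp: delta_def)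
  then show ?thesis using assms by simp
qed

lemma act_one:
  assumes "length w = n"
  shows "act n (one n) w = delta w"
proof -
  have "[1..<n + 1] \<in> perms n" by (auto simp: perms_def)
  moreover have "perm_mult [1..<n + 1] w = w"
    using map_nth_upt[of n w 0] assms by (simp add: perm_mult_def)
  ultimately show ?thesis unfolding one_def by (intro ext) (simp add: act_delta)
qed

lemma act_diff: "act n (x - y) w z = act n x w z - act n y w z"
  unfolding act_alt by (subst sum_subtractf[symmetric]) (auto intro!: sum.cong)

lemma act_prodl_Cons:
  assumes "distinct w" "length w = n"
  shows "act n (prodl n (x # xs)) w z = lext (set w) (act n (prodl n xs) w) (\<lambda>u. act n x u z)"
  unfolding prodl_def using act_conv[OF assms] by simp

lemma lext_delta_append:
  assumes "supported A x"
  shows "lext A x (\<lambda>u. delta (s @ u @ r) z) = cat (delta s) (cat x (delta r)) z"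
proof -
  have "cat x (delta r) = (\<lambda>z. lext A x (\<lambda>u. delta (u @ r) z))"
    using cat_lext_left[of A x delta "delta r"] by (auto simp: lext_delta_right[OF assms] cat_delta_delta)
  then show ?thesis by (simp add: cat_lext_right cat_delta_delta)
qed

section \<open>The Dynkin operator on words\<close>

lemma cyc_in_perms:
  assumes "1 \<le> i" "i \<le> m"
  shows "cyc m i \<in> perms m"
  using assms by (auto simp: cyc_def perms_def)

text \<open>The cycle c_i pulls the i-th letter to the front, so 1 - c_i replaces an initial segment
  ub, with b in place i, by ub - bu.\<close>

lemma perm_mult_cyc:
  "perm_mult (cyc (length u + Suc (length r)) (Suc (length u))) (u @ b # r) = b # u @ r"
  using map_nth_upt[of "length u" "u @ b # r" 0]
    map_nth_upt[of "length u + Suc (length r)" "u @ b # r" "Suc (length u)"]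
  by (simp add: perm_mult_def cyc_def)

text \<open>Once the factors for 2, ..., k have acted, the first k letters are bracketed and the
  others untouched. The next factor appends or prepends the next letter to each term of the bracket,
  that is, brackets with it.\<close>

lemma act_omega_partial:
  fixes w :: "nat list"
  assumes "distinct w" "length w = m" "1 \<le> k" "k \<le> m"
  shows "act m (prodl m (map (\<lambda>i. one m - delta (cyc m i)) (rev [2..<k + 1]))) w
    = (cat (left_normed (take k w)) (delta (drop k w)) :: 'a::field comb)"
  using assms(3,4)
proof (induction k rule: dec_induct)
  case base
  then obtain a u where "w = a # u" using assms(2) by (cases w) auto
  then show ?case using assms(2) by (simp add: prodl_def act_one left_normed_Cons cat_delta_delta)
next
  case (step k)
  let ?u = "take k w" and ?b = "w ! k" and ?r = "drop (Suc k) w"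
  have w: "w = ?u @ ?b # ?r" using step.prems assms(2) by (simp add: id_take_nth_drop)
  have d: "distinct (?u @ ?b # ?r)" using assms(1) w by metis
  have len: "length ?u = k" "length ?r = m - Suc k" using step.prems assms(2) by auto
  have dr: "drop k w = ?b # ?r" using step.prems assms(2) by (simp add: Cons_nth_drop_Suc)
  have tk: "take (Suc k) w = ?u @ [?b]" using step.prems assms(2) by (simp add: take_Suc_conv_app_nth)
  have sup: "supported (set ?u) (left_normed ?u :: 'a comb)" using supported_left_normed[of ?u] assms(1) by simp
  let ?X = "prodl m (map (\<lambda>i. one m - delta (cyc m i)) (rev [2..<k + 1])) :: 'a comb"
  have X: "act m ?X w = cat (left_normed ?u) (delta (?b # ?r))"
    by (subst dr[symmetric], rule step.IH) (use step.prems in simp)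
  show ?case
  proof
    fix z
    have "act m (prodl m (map (\<lambda>i. one m - delta (cyc m i)) (rev [2..<Suc k + 1]))) w z =
      lext (set w) (act m ?X w) (\<lambda>u. act m (one m - delta (cyc m (Suc k))) u z)"
      using step.hyps by (simp add: act_prodl_Cons[OF assms(1,2)])
    also have "\<dots> = lext (set ?u \<union> set (?b # ?r)) (cat (left_normed ?u) (delta (?b # ?r))) (\<lambda>u. act m (one m - delta (cyc m (Suc k))) u z)"
      unfolding X by (metis w set_append)
    also have "\<dots> = lext (set ?u) (left_normed ?u) (\<lambda>u. act m (one m - delta (cyc m (Suc k))) (u @ ?b # ?r) z)"
      using d by (subst lext_cat[OF sup supported_delta]) (auto simp: lext_delta)
    also have "\<dots> = lext (set ?u) (left_normed ?u) (\<lambda>u. delta ([] @ u @ ?b # ?r) z - delta ([?b] @ u @ ?r) z)"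
    proof (rule lext_cong)
      fix u assume "u \<in> permutations_of_set (set ?u)"
      then have lu: "length u = k"
        using len(1) d by (metis distinct_append distinct_card length_finite_permutations_of_set)
      then have lw: "length (u @ ?b # ?r) = m" using len step.prems by simp
      have m: "m = length u + Suc (length ?r)" using lu lw by simp
      have "cyc m (Suc k) \<in> perms m" using step.prems by (intro cyc_in_perms) auto
      moreover have "perm_mult (cyc m (Suc k)) (u @ ?b # ?r) = ?b # u @ ?r"
        using perm_mult_cyc[of u ?r ?b] m lu by simp
      ultimately show "act m (one m - delta (cyc m (Suc k))) (u @ ?b # ?r) z =
          (delta ([] @ u @ ?b # ?r) z - delta ([?b] @ u @ ?r) z :: 'a)"
        using lw by (simp add: act_diff act_one act_delta)
    qed
    also have "\<dots> = cat (left_normed ?u) (delta (?b # ?r)) z - cat (delta [?b]) (cat (left_normed ?u) (delta ?r)) z"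
      unfolding lext_diff lext_delta_append[OF sup] by simp
    also have "\<dots> = cat (bracket (left_normed ?u) (delta [?b])) (delta ?r) z"
      unfolding bracket_def cat_diff_left cat_assoc cat_delta_delta by simp
    also have "bracket (left_normed ?u) (delta [?b]) = left_normed (take (Suc k) w)"
      using step.hyps step.prems assms(2) unfolding tk by (subst left_normed_snoc) auto
    finally show "act m (prodl m (map (\<lambda>i. one m - delta (cyc m i)) (rev [2..<Suc k + 1]))) w z =
      (cat (left_normed (take (Suc k) w)) (delta ?r) z :: 'a)" .
  qed
qed

lemma Qw_eq_left_normed:
  assumes "distinct w"
  shows "Qw w = left_normed w"
proof (cases "w = []")
  case True
  then show ?thesis by (simp add: Qw_def omega_def prodl_def act_one)
next
  case False
  then have "length w \<ge> 1" by (cases w) auto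
  then show ?thesis
    using act_omega_partial[OF assms refl, of "length w"] by (simp add: Qw_def omega_def)
qed

lemma act_omega: "distinct w \<Longrightarrow> act (length w) (omega (length w)) w = left_normed w"
  using Qw_eq_left_normed[of w] by (simp add: Qw_def)

section \<open>Shifted operators acting on consecutive blocks\<close>

lemma shiftw_in_perms:
  assumes "s \<in> perms m" "r + m \<le> n"
  shows "shiftw n r s \<in> perms n"
proof -
  have s: "distinct s" "set s = {1..m}" "length s = m" using assms length_perms by (auto simp: perms_def)
  have "set (map (\<lambda>j. j + r) s) = {r + 1..r + m}"
    using s(2) by (simp add: add.commute[of _ r] image_add_atLeastAtMost)
  moreover have "distinct (map (\<lambda>j. j + r) s)" using s by (simp add: distinct_map)
  ultimately show ?thesis using assms(2) s(3) unfolding shiftw_def perms_def by auto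
qed

lemma perm_mult_shiftw:
  assumes "s \<in> perms (length b)"
  shows "perm_mult (shiftw (length (a @ b @ c)) (length a) s) (a @ b @ c) = a @ perm_mult s b @ c"
proof -
  have s: "set s = {1..length b}" "length s = length b" using assms length_perms by (auto simp: perms_def)
  have "map (\<lambda>j. (a @ b @ c) ! (j - 1)) [0 + 1..<length a + 1] = a"
    by (subst map_nth_upt) auto
  moreover have "map (\<lambda>j. (a @ b @ c) ! (j - 1)) [(length a + length b) + 1..<length (a @ b @ c) + 1] = c"
    by (subst map_nth_upt) auto
  moreover have "map (\<lambda>j. (a @ b @ c) ! (j + length a - 1)) s = map (\<lambda>j. b ! (j - 1)) s"
  proof (rule map_cong[OF refl])
    fix j assume "j \<in> set s"
    then have "j + length a - 1 = length a + (j - 1)" "j - 1 < length b" using s by auto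
    then show "(a @ b @ c) ! (j + length a - 1) = b ! (j - 1)" by (simp add: nth_append)
  qed
  ultimately show ?thesis by (simp add: perm_mult_def shiftw_def s o_def add.assoc)
qed

lemma act_shift:
  assumes "distinct b" "n = length (a @ b @ c)"
  shows "act n (shift n (length a) (length b) x) (a @ b @ c) z = cat (delta a) (cat (act (length b) x b) (delta c)) z"
proof -
  let ?w = "a @ b @ c" and ?m = "length b"
  have "act n (shift n (length a) ?m x) ?w z = (\<Sum>t\<in>perms n. \<Sum>s\<in>perms ?m.
     if shiftw n (length a) s = t then x s * delta (perm_mult t ?w) z else 0)"
    unfolding act_alt shift_def by (intro sum.cong refl) (auto simp: delta_def intro!: sum.cong sum.neutral)
  also have "\<dots> = (\<Sum>s\<in>perms ?m. \<Sum>t\<in>perms n.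
     if shiftw n (length a) s = t then x s * delta (perm_mult t ?w) z else 0)"
    by (rule sum.swap)
  also have "\<dots> = (\<Sum>s\<in>perms ?m. x s * delta (a @ perm_mult s b @ c) z)"
  proof (intro sum.cong refl)
    fix s assume s: "s \<in> perms ?m"
    then have "shiftw n (length a) s \<in> perms n" using assms(2) by (intro shiftw_in_perms) auto
    moreover have "perm_mult (shiftw n (length a) s) ?w = a @ perm_mult s b @ c"
      using perm_mult_shiftw[OF s, of a c] assms(2) by simp
    ultimately show "(\<Sum>t\<in>perms n. if shiftw n (length a) s = t then x s * delta (perm_mult t ?w) z else 0)
      = x s * delta (a @ perm_mult s b @ c) z"
      by simp
  qed
  also have "\<dots> = lext (set b) (act ?m x b) (\<lambda>u. delta (a @ u @ c) z)"
    by (simp add: lext_act[OF assms(1) refl])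
  also have "\<dots> = cat (delta a) (cat (act ?m x b) (delta c)) z"
    by (rule lext_delta_append[OF supported_act[OF assms(1) refl]])
  finally show ?thesis .
qed

text \<open>The last block is processed first. When the turn of block \<open>i\<close> comes,
  everything up to its end is still a plain word, so the factor with offset \<open>psum q i\<close>
  meets that block unpermuted; the terms behind it have constant length.\<close>

lemma act_omega_up_partial:
  assumes "distinct (concat us)" "map length us = q" "n = sum_list q" "i \<le> length q"
  shows "act n (prodl n (map (\<lambda>j. shift n (psum q j) (q ! j) (omega (q ! j))) [i..<length q])) (concat us)
    = (cat (delta (concat (take i us))) (left_normed_prod (drop i us)) :: 'a::field comb)"
  using assms(4)
proof (induction i rule: inc_induct)
  case base
  have "length (concat us) = n" using assms by (simp add: length_concat)
  then show ?case using assms(2) by (auto simp: prodl_def act_one)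
next
  case (step i)
  let ?w = "concat us"
  let ?a = "concat (take i us)" and ?b = "us ! i" and ?R = "drop (Suc i) us"
  let ?Y = "\<lambda>j. shift n (psum q j) (q ! j) (omega (q ! j)) :: 'a comb"
  have lw: "length ?w = n" using assms by (simp add: length_concat)
  have i: "i < length us" using step assms(2) by auto
  have us: "us = take i us @ ?b # ?R" using i by (simp add: id_take_nth_drop)
  have w: "?w = (?a @ ?b) @ concat ?R" by (subst us) simp
  have tk: "concat (take (Suc i) us) = ?a @ ?b" using i by (simp add: take_Suc_conv_app_nth)
  have d: "distinct ((?a @ ?b) @ concat ?R)" using assms(1) w by metis
  have qi: "q ! i = length ?b" using assms(2) i by auto
  have ps: "psum q i = length ?a"
    unfolding psum_def assms(2)[symmetric] by (simp add: length_concat take_map)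
  show ?case
  proof
    fix z
    have "act n (prodl n (map ?Y [i..<length q])) ?w z =
      lext (set ?w) (act n (prodl n (map ?Y [Suc i..<length q])) ?w) (\<lambda>u. act n (?Y i) u z)"
      using step.hyps by (simp add: upt_conv_Cons act_prodl_Cons[OF assms(1) lw])
    also have "\<dots> = lext (set (?a @ ?b) \<union> set (concat ?R)) (cat (delta (?a @ ?b)) (left_normed_prod ?R)) (\<lambda>u. act n (?Y i) u z)"
      unfolding step.IH tk by (metis w set_append)
    also have "\<dots> = lext (set (concat ?R)) (left_normed_prod ?R) (\<lambda>v. act n (?Y i) ((?a @ ?b) @ v) z)"
    proof (subst lext_cat[OF supported_delta supported_left_normed_prod])
      show "distinct (?a @ ?b)" "distinct (concat ?R)" "set (?a @ ?b) \<inter> set (concat ?R) = {}"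
        using d unfolding distinct_append by blast+
      then show "lext (set (?a @ ?b)) (delta (?a @ ?b)) (\<lambda>u. lext (set (concat ?R)) (left_normed_prod ?R) (\<lambda>v. act n (?Y i) (u @ v) z)) =
        lext (set (concat ?R)) (left_normed_prod ?R) (\<lambda>v. act n (?Y i) ((?a @ ?b) @ v) z)"
        by (intro lext_delta) auto
    qed auto
    also have "\<dots> = lext (set (concat ?R)) (left_normed_prod ?R) (\<lambda>v. cat (delta ?a) (cat (left_normed ?b) (delta v)) z)"
    proof (rule lext_cong)
      fix v assume "v \<in> permutations_of_set (set (concat ?R))"
      then have "length v = length (concat ?R)"
        using d by (metis distinct_append distinct_card length_finite_permutations_of_set)
      then have "n = length (?a @ ?b @ v)" using lw w by (metis append_assoc length_append)
      moreover have "distinct ?b" using d by simp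
      ultimately show "act n (?Y i) ((?a @ ?b) @ v) z = cat (delta ?a) (cat (left_normed ?b) (delta v)) z"
        unfolding qi ps append_assoc by (simp add: act_shift act_omega)
    qed
    also have "\<dots> = cat (delta ?a) (cat (left_normed ?b) (\<lambda>z. lext (set (concat ?R)) (left_normed_prod ?R) (\<lambda>v. delta v z))) z"
      by (simp add: cat_lext_right flip: cat_assoc)
    also have "(\<lambda>z. lext (set (concat ?R)) (left_normed_prod ?R) (\<lambda>v. delta v z)) = (left_normed_prod ?R :: 'a comb)"
      using d by (intro ext lext_delta_right supported_left_normed_prod) simp
    finally show "act n (prodl n (map ?Y [i..<length q])) ?w z = cat (delta ?a) (left_normed_prod (drop i us)) z"
      using i by (simp flip: Cons_nth_drop_Suc)
  qed
qed

lemma act_omega_up: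
  assumes "distinct (concat us)" "map length us = q" "n = sum_list q"
  shows "act n (omega_up n q) (concat us) = left_normed_prod us"
  using act_omega_up_partial[OF assms, of 0] by (simp add: omega_up_def)

section \<open>Splitting words along a composition\<close>

fun cut :: "nat list \<Rightarrow> 'b list \<Rightarrow> 'b list list" where
  "cut [] w = []"
| "cut (m # q) w = take m w # cut q (drop m w)"

lemma concat_cut: "length w = sum_list q \<Longrightarrow> concat (cut q w) = w"
  by (induction q arbitrary: w) auto

lemma map_length_cut: "length w = sum_list q \<Longrightarrow> map length (cut q w) = q"
  by (induction q arbitrary: w) auto

text \<open>A descent at the junction depends on both words, hence the removal of
  \<open>length a\<close>. Junctions are the places where the sum in \<open>Xi\<close> leaves
  descents free.\<close>

lemma descents_append:
  "descents (a @ b) - {length a} = descents a \<union> (+) (length a) ` descents b"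
proof (intro set_eqI iffI)
  fix i assume i: "i \<in> descents (a @ b) - {length a}"
  show "i \<in> descents a \<union> (+) (length a) ` descents b"
  proof (cases "i < length a")
    case True
    then show ?thesis using i by (auto simp: descents_def nth_append split: if_splits)
  next
    case False
    then obtain j where j: "i = length a + Suc j"
      using i by (metis Diff_iff Suc_diff_Suc add_diff_inverse_nat diff_is_0_eq insertI1 leI le_antisym nat_neq_iff zero_less_diff)
    then have "Suc j \<in> descents b" using i by (auto simp: descents_def nth_append)
    then show ?thesis using j by blast
  qed
next
  fix i assume "i \<in> descents a \<union> (+) (length a) ` descents b"
  then show "i \<in> descents (a @ b) - {length a}"
    by (auto simp: descents_def nth_append Suc_diff_le)
qed

lemma descents_empty_iff: "descents w = {} \<longleftrightarrow> sorted w"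
proof -
  have "descents w = {} \<longleftrightarrow> (\<forall>i. Suc i < length w \<longrightarrow> w ! i \<le> w ! Suc i)"
  proof
    assume d: "descents w = {}"
    show "\<forall>i. Suc i < length w \<longrightarrow> w ! i \<le> w ! Suc i"
    proof (intro allI impI)
      fix i assume "Suc i < length w"
      then show "w ! i \<le> w ! Suc i" using d unfolding descents_def by (auto dest: spec[of _ "Suc i"])
    qed
  next
    assume s: "\<forall>i. Suc i < length w \<longrightarrow> w ! i \<le> w ! Suc i"
    have "i \<notin> descents w" for i
      using s[rule_format, of "i - 1"] by (cases i) (auto simp: descents_def)
    then show "descents w = {}" by blast
  qed
  then show ?thesis by (simp add: sorted_iff_nth_Suc)
qed

lemma psum_Cons_set:
  "{psum (m # q) j |j. 1 \<le> j \<and> j \<le> length (m # q)} =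
    insert m ((+) m ` {psum q j |j. 1 \<le> j \<and> j \<le> length q})"
proof (intro set_eqI iffI)
  fix x assume "x \<in> {psum (m # q) j |j. 1 \<le> j \<and> j \<le> length (m # q)}"
  then obtain j where j: "x = psum (m # q) (Suc j)" "j \<le> length q" by (auto simp: Suc_le_eq gr0_conv_Suc)
  then show "x \<in> insert m ((+) m ` {psum q j |j. 1 \<le> j \<and> j \<le> length q})"
    by (cases j) (auto simp: psum_def)
next
  fix x assume "x \<in> insert m ((+) m ` {psum q j |j. 1 \<le> j \<and> j \<le> length q})"
  then consider "x = m" | j where "x = m + psum q j" "1 \<le> j" "j \<le> length q" by auto
  then show "x \<in> {psum (m # q) j |j. 1 \<le> j \<and> j \<le> length (m # q)}"
  proof cases
    case 1
    then show ?thesis by (auto simp: psum_def intro!: exI[of _ 1])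
  next
    case 2
    then show ?thesis by (auto simp: psum_def intro!: exI[of _ "Suc j"])
  qed
qed

lemma descents_subset_iff:
  assumes "length w = sum_list q"
  shows "descents w \<subseteq> {psum q j |j. 1 \<le> j \<and> j \<le> length q} \<longleftrightarrow> (\<forall>b\<in>set (cut q w). sorted b)"
  using assms
proof (induction q arbitrary: w)
  case Nil
  then show ?case by (auto simp: descents_def)
next
  case (Cons m q)
  let ?a = "take m w" and ?b = "drop m w"
  let ?P = "{psum q j |j. 1 \<le> j \<and> j \<le> length q}"
  have la: "length ?a = m" using Cons.prems by simp
  have D: "descents w - {m} = descents ?a \<union> (+) m ` descents ?b"
    using descents_append[of ?a ?b] la by simp
  have lt: "i < m" if "i \<in> descents ?a" for i using that la by (auto simp: descents_def)
  have gt: "i > 0" if "i \<in> descents ?b" for i using that by (auto simp: descents_def)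
  have "descents w \<subseteq> insert m ((+) m ` ?P) \<longleftrightarrow> descents w - {m} \<subseteq> (+) m ` ?P" by blast
  also have "\<dots> \<longleftrightarrow> descents ?a \<subseteq> (+) m ` ?P \<and> (+) m ` descents ?b \<subseteq> (+) m ` ?P"
    unfolding D by blast
  \<comment> \<open>The shifted partial sums are at least \<open>m\<close>, whereas every descent of
    the first piece is below \<open>m\<close>.\<close>
  also have "descents ?a \<subseteq> (+) m ` ?P \<longleftrightarrow> descents ?a = {}"
    using lt by fastforce
  also have "(+) m ` descents ?b \<subseteq> (+) m ` ?P \<longleftrightarrow> descents ?b \<subseteq> ?P"
    by (rule inj_image_subset_iff) simp
  finally show ?case
    using Cons unfolding psum_Cons_set by (simp add: descents_empty_iff)
qed

lemma sorted_list_of_set_filter: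
  assumes "finite A" "B \<subseteq> A"
  shows "filter (\<lambda>x. x \<in> B) (sorted_list_of_set A) = sorted_list_of_set (B :: nat set)"
  by (rule sorted_distinct_set_unique)
    (use assms finite_subset[OF assms(2,1)] in \<open>auto simp: sorted_wrt_filter\<close>)

text \<open>A word with increasing pieces is determined by the sets of positions in its pieces.
  Reading positions through \<open>f\<close> turns such a set into a set of letters and its
  increasing listing into a subword; this is how \<open>Xi\<close> produces unshuffles. The general
  position set \<open>A\<close> is what remains after some pieces are removed.\<close>

lemma sum_sorted_blocks:
  fixes f :: "nat \<Rightarrow> nat"
  assumes "finite A" "inj_on f A" "card A = sum_list q"
  shows "(\<Sum>s | s \<in> permutations_of_set A \<and> (\<forall>b\<in>set (cut q s). sorted b). left_normed_prod (cut q (map f s)) z)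
    = (lie_unshuffle q (map f (sorted_list_of_set A)) z :: 'a::field)"
  using assms
proof (induction q arbitrary: A z)
  case Nil
  then show ?case by simp
next
  case (Cons m q)
  note inj = Cons.prems(2)
  let ?sl = "sorted_list_of_set :: nat set \<Rightarrow> nat list"
  let ?I = "{B. B \<subseteq> A \<and> card B = m}"
  let ?R = "\<lambda>q A. {s. s \<in> permutations_of_set A \<and> (\<forall>b\<in>set (cut q s). sorted b)}"
  have fB: "finite B" if "B \<in> ?I" for B using that Cons.prems(1) finite_subset by auto
  have finI: "finite ?I" by (rule finite_subset[of _ "Pow A"]) (use Cons.prems in auto)
  have "(\<Sum>s\<in>?R (m # q) A. left_normed_prod (cut (m # q) (map f s)) z) =
    (\<Sum>(B, s)\<in>(SIGMA B:?I. ?R q (A - B)). cat (left_normed (map f (?sl B))) (left_normed_prod (cut q (map f s))) z :: 'a)"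
  proof (rule sum.reindex_bij_witness[where i = "\<lambda>(B, s). ?sl B @ s" and j = "\<lambda>s. (set (take m s), drop m s)"])
    fix s assume s: "s \<in> ?R (m # q) A"
    then have ds: "distinct s" "set s = A" by (auto simp: permutations_of_set_def)
    have ls: "length s = card A" using ds distinct_card by metis
    have "distinct (take m s @ drop m s)" "set (take m s @ drop m s) = A" using ds by simp_all
    then have "set (drop m s) = A - set (take m s)" unfolding distinct_append set_append by blast
    moreover have "card (set (take m s)) = m" "set (take m s) \<subseteq> A"
      using ds ls Cons.prems by (auto simp: distinct_card dest: in_set_takeD)
    ultimately show "(set (take m s), drop m s) \<in> (SIGMA B:?I. ?R q (A - B))"
      using s ds by (auto simp: permutations_of_set_def)
    have "?sl (set (take m s)) = take m s"
      using s ds by (intro sorted_distinct_set_unique) auto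
    then show "(case (set (take m s), drop m s) of (B, s) \<Rightarrow> ?sl B @ s) = s"
      and "(case (set (take m s), drop m s) of (B, s) \<Rightarrow> cat (left_normed (map f (?sl B))) (left_normed_prod (cut q (map f s))) z) =
        left_normed_prod (cut (m # q) (map f s)) z"
      by (simp_all add: take_map drop_map)
  next
    fix p assume "p \<in> (SIGMA B:?I. ?R q (A - B))"
    then obtain B s where p: "p = (B, s)" and B: "B \<in> ?I" and s: "s \<in> ?R q (A - B)" by auto
    have l: "length (?sl B) = m" "set (?sl B) = B" using B fB[OF B] by auto
    then show "(set (take m (case p of (B, s) \<Rightarrow> ?sl B @ s)), drop m (case p of (B, s) \<Rightarrow> ?sl B @ s)) = p"
      using p by simp
    show "(case p of (B, s) \<Rightarrow> ?sl B @ s) \<in> ?R (m # q) A"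
      using p l s B by (auto simp: permutations_of_set_def)
  qed
  also have "\<dots> = (\<Sum>B\<in>?I. \<Sum>s\<in>?R q (A - B). cat (left_normed (map f (?sl B))) (left_normed_prod (cut q (map f s))) z)"
    using finI by (intro sum.Sigma[symmetric]) auto
  also have "\<dots> = (\<Sum>B\<in>?I. cat (left_normed (map f (?sl B))) (lie_unshuffle q (map f (?sl (A - B)))) z)"
  proof (rule sum.cong[OF refl])
    fix B assume B: "B \<in> ?I"
    have "card (A - B) = sum_list q" using B fB[OF B] Cons.prems by (simp add: card_Diff_subset)
    then have "lie_unshuffle q (map f (?sl (A - B))) = (\<lambda>z. \<Sum>s\<in>?R q (A - B). left_normed_prod (cut q (map f s)) z :: 'a)"
      using Cons.prems by (intro ext Cons.IH[symmetric]) (auto intro: inj_on_subset)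
    then show "(\<Sum>s\<in>?R q (A - B). cat (left_normed (map f (?sl B))) (left_normed_prod (cut q (map f s))) z)
      = (cat (left_normed (map f (?sl B))) (lie_unshuffle q (map f (?sl (A - B)))) z :: 'a)"
      by (simp add: cat_sum_right)
  qed
  also have "\<dots> = (\<Sum>B\<in>?I. cat (left_normed (filter (\<lambda>x. x \<in> f ` B) (map f (?sl A))))
      (lie_unshuffle q (filter (\<lambda>x. x \<notin> f ` B) (map f (?sl A)))) z)"
  proof (rule sum.cong[OF refl])
    fix B assume B: "B \<in> ?I"
    have iff: "f x \<in> f ` B \<longleftrightarrow> x \<in> B" if "x \<in> A" for x
      using inj B that by (auto dest: inj_onD)
    have "filter (\<lambda>x. x \<in> f ` B) (map f (?sl A)) = map f (filter (\<lambda>x. x \<in> B) (?sl A))"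
      unfolding filter_map o_def
      by (intro arg_cong[of _ _ "map f"] filter_cong refl) (use iff Cons.prems(1) in simp)
    moreover have "filter (\<lambda>x. x \<notin> f ` B) (map f (?sl A)) = map f (filter (\<lambda>x. x \<in> A - B) (?sl A))"
      unfolding filter_map o_def
      by (intro arg_cong[of _ _ "map f"] filter_cong refl) (use iff Cons.prems(1) in simp)
    ultimately show "cat (left_normed (map f (?sl B))) (lie_unshuffle q (map f (?sl (A - B)))) z =
      (cat (left_normed (filter (\<lambda>x. x \<in> f ` B) (map f (?sl A)))) (lie_unshuffle q (filter (\<lambda>x. x \<notin> f ` B) (map f (?sl A)))) z :: 'a)"
      using B Cons.prems(1) by (simp only: sorted_list_of_set_filter mem_Collect_eq Diff_subset)
  qed
  also have "\<dots> = lie_unshuffle (m # q) (map f (?sl A)) z"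
  proof -
    have "bij_betw ((`) f) ?I {B. B \<subseteq> f ` A \<and> card B = m}"
    proof (rule bij_betw_imageI)
      show "inj_on ((`) f) ?I"
        using inj_on_image_Pow[OF inj] by (rule inj_on_subset) auto
      show "(`) f ` ?I = {B. B \<subseteq> f ` A \<and> card B = m}"
      proof (intro set_eqI iffI)
        fix B assume "B \<in> {B. B \<subseteq> f ` A \<and> card B = m}"
        then obtain C where "C \<subseteq> A" "B = f ` C" "card B = m" by (auto simp: subset_image_iff)
        then show "B \<in> (`) f ` ?I" using inj by (auto simp: card_image inj_on_subset)
      qed (use inj in \<open>auto simp: card_image inj_on_subset\<close>)
    qed
    then show ?thesis
      using sum.reindex_bij_betw[of "(`) f" ?I "{B. B \<subseteq> f ` A \<and> card B = m}"
         "\<lambda>B. cat (left_normed (filter (\<lambda>x. x \<in> B) (map f (?sl A)))) (lie_unshuffle q (filter (\<lambda>x. x \<notin> B) (map f (?sl A)))) z"]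
        Cons.prems(1) by simp
  qed
  finally show ?case .
qed

lemma act_omega_q:
  assumes q: "n = sum_list q" and w: "w \<in> perms n"
  shows "act n (omega_q n q) w z = (lie_unshuffle q w z :: 'a::field)"
proof -
  let ?f = "\<lambda>j. w ! (j - 1)"
  have dw: "distinct w" and lw: "length w = n" using w length_perms by (auto simp: perms_def)
  have "act n (omega_q n q) w z = (\<Sum>s\<in>perms n. Xi n q s * act n (omega_up n q) (perm_mult s w) z :: 'a)"
    unfolding omega_q_def act_conv[OF dw lw] lext_act[OF dw lw] ..
  also have "\<dots> = (\<Sum>s\<in>perms n. if (\<forall>b\<in>set (cut q s). sorted b) then left_normed_prod (cut q (perm_mult s w)) z else 0)"
  proof (rule sum.cong[OF refl])
    fix s assume s: "s \<in> perms n"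
    then have ls: "length s = sum_list q" using q length_perms by simp
    have lu: "length (perm_mult s w) = sum_list q" using ls by (simp add: perm_mult_def)
    have "distinct (perm_mult s w)" using perm_mult_in_perms[OF s w] by (simp add: perms_def)
    then have "act n (omega_up n q) (perm_mult s w) = (left_normed_prod (cut q (perm_mult s w)) :: 'a comb)"
      using act_omega_up[of "cut q (perm_mult s w)" q n, where ?'a = 'a] q by (simp add: concat_cut[OF lu] map_length_cut[OF lu])
    then show "Xi n q s * act n (omega_up n q) (perm_mult s w) z =
      (if (\<forall>b\<in>set (cut q s). sorted b) then left_normed_prod (cut q (perm_mult s w)) z else 0 :: 'a)"
      using s descents_subset_iff[OF ls] by (simp add: Xi_def)
  qed
  also have "\<dots> = (\<Sum>s\<in>{s \<in> perms n. \<forall>b\<in>set (cut q s). sorted b}. left_normed_prod (cut q (perm_mult s w)) z)"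
    by (rule sum.inter_filter[symmetric]) simp
  also have "\<dots> = lie_unshuffle q (map ?f (sorted_list_of_set {1..n})) z"
    unfolding perms_eq perm_mult_def
  proof (rule sum_sorted_blocks)
    show "inj_on ?f {1..n}" using dw lw by (auto simp: inj_on_def nth_eq_iff_index_eq)
  qed (use q in auto)
  also have "map ?f (sorted_list_of_set {1..n}) = w"
  proof -
    have "sorted_list_of_set {1..n} = [0 + 1..<n + 1]"
      by (intro sorted_distinct_set_unique) (auto simp del: upt_Suc)
    then show ?thesis using lw by (simp only: map_nth_upt) simp
  qed
  finally show ?thesis .
qed

lemma conv_omega_q:
  assumes "n = sum_list q"
  shows "conv n (omega_q n q) y z = lext {1..n} y (\<lambda>w. lie_unshuffle q w z)"
  unfolding conv_act lext_def perms_eq[symmetric]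
  by (rule sum.cong) (simp_all add: act_omega_q[OF assms])

section \<open>Cycle decompositions\<close>

definition is_cycle :: "(nat \<Rightarrow> nat) \<Rightarrow> nat list \<Rightarrow> bool" where
  "is_cycle f t \<longleftrightarrow> (\<forall>k<length t. f (t ! k) = t ! (Suc k mod length t))"

lemma is_cycle_funpow:
  assumes "is_cycle f t" "k < length t"
  shows "(f ^^ j) (t ! k) = t ! ((k + j) mod length t)"
proof (induction j)
  case (Suc j)
  have "(k + j) mod length t < length t" using assms(2) by (intro mod_less_divisor) auto
  then show ?case using assms Suc by (simp add: is_cycle_def mod_Suc_eq)
qed (use assms in simp)

lemma is_cycle_orbit:
  assumes "is_cycle f t" "x \<in> set t"
  shows "{(f ^^ j) x |j. True} = set t"
proof -
  obtain k where k: "k < length t" "t ! k = x" using assms(2) by (auto simp: in_set_conv_nth)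
  have "t ! i \<in> {(f ^^ j) x |j. True}" if "i < length t" for i
  proof -
    have "(k + (length t - k + i)) mod length t = i" using k that by simp
    then have "(f ^^ (length t - k + i)) x = t ! i"
      using is_cycle_funpow[OF assms(1) k(1)] k(2) by metis
    then show ?thesis by (auto intro!: exI[of _ "length t - k + i"])
  qed
  moreover have "(f ^^ j) x \<in> set t" for j
    using is_cycle_funpow[OF assms(1) k(1), of j] k
    by (metis in_set_conv_nth length_greater_0_conv less_zeroE list.size(3) mod_less_divisor)
  ultimately show ?thesis by (auto simp: in_set_conv_nth)
qed

text \<open>Cycles that meet are listings of the same orbit. Both start at its minimum, and
  iterating \<open>f\<close> from there determines all further entries.\<close>

lemma is_cycle_unique:
  assumes "minfirst s" "minfirst t" "is_cycle f s" "is_cycle f t" "set s \<inter> set t \<noteq> {}"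
  shows "s = t"
proof -
  obtain x where "x \<in> set s" "x \<in> set t" using assms(5) by blast
  then have st: "set s = set t" using is_cycle_orbit assms(3,4) by metis
  then have len: "length s = length t" using assms(1,2) distinct_card unfolding minfirst_def by metis
  have "s ! 0 = t ! 0" using assms(1,2) st by (metis minfirst_def hd_conv_nth)
  moreover have "0 < length s" using assms(1) by (simp add: minfirst_def)
  ultimately have "s ! k = t ! k" if "k < length s" for k
    using is_cycle_funpow[OF assms(3), of 0 k] is_cycle_funpow[OF assms(4), of 0 k] that len by simp
  then show ?thesis using len by (simp add: nth_equalityI)
qed

section \<open>Orbits of an injective self-map of a finite set\<close>

lemma funpow_closed: "f ` A \<subseteq> A \<Longrightarrow> x \<in> A \<Longrightarrow> (f ^^ j) x \<in> A"
  by (induction j) auto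

lemma funpow_cancel:
  assumes "inj_on f A" "f ` A \<subseteq> A" "x \<in> A" "(f ^^ i) x = (f ^^ (i + d)) x"
  shows "(f ^^ d) x = x"
  using assms(4)
proof (induction i)
  case (Suc i)
  have "(f ^^ i) x \<in> A" "(f ^^ (i + d)) x \<in> A" using funpow_closed[OF assms(2,3)] by auto
  then have "(f ^^ i) x = (f ^^ (i + d)) x" using Suc.prems assms(1) by (auto dest: inj_onD)
  then show ?case by (rule Suc.IH)
qed simp

lemma funpow_periodic:
  assumes "finite A" "inj_on f A" "f ` A \<subseteq> A" "x \<in> A"
  obtains d where "d > 0" "(f ^^ d) x = x"
proof -
  have "finite (range (\<lambda>j. (f ^^ j) x))"
    by (rule finite_subset[OF _ assms(1)]) (use funpow_closed[OF assms(3,4)] in auto)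
  then have "\<not> inj (\<lambda>j. (f ^^ j) x)" using finite_imageD by blast
  then obtain i j where "(f ^^ i) x = (f ^^ j) x" "i < j"
    unfolding inj_def by (metis nat_neq_iff)
  then show ?thesis
    using that[of "j - i"] funpow_cancel[OF assms(2-4), of i "j - i"] by simp
qed

lemma funpow_mult_periodic: "(f ^^ d) x = x \<Longrightarrow> (f ^^ (d * a)) x = x"
  by (induction a) (simp_all add: funpow_add)

lemma is_cycle_exists:
  assumes "finite A" "inj_on f A" "f ` A \<subseteq> A" "x \<in> A"
  obtains t where "minfirst t" "is_cycle f t" "set t \<subseteq> A" "x \<in> set t"
proof -
  let ?O = "{(f ^^ j) x |j. True}"
  have OA: "?O \<subseteq> A" using funpow_closed[OF assms(3,4)] by auto
  then have finO: "finite ?O" using assms(1) finite_subset by blast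
  define m where "m = Min ?O"
  have "m \<in> ?O" unfolding m_def using finO by (intro Min_in) auto
  then obtain a where a: "m = (f ^^ a) x" by blast
  have mA: "m \<in> A" using \<open>m \<in> ?O\<close> OA by blast
  \<comment> \<open>The least return time of the orbit minimum: the return closes the cycle, and
    minimality makes the listed iterates distinct.\<close>
  define d where "d = (LEAST d. d > 0 \<and> (f ^^ d) m = m)"
  obtain d' where "d' > 0" "(f ^^ d') m = m" using funpow_periodic[OF assms(1-3) mA] .
  then have d: "d > 0" "(f ^^ d) m = m"
    unfolding d_def using LeastI[of "\<lambda>d. d > 0 \<and> (f ^^ d) m = m" d'] by auto
  have least: "(f ^^ e) m \<noteq> m" if "0 < e" "e < d" for e
    using not_less_Least[of e "\<lambda>d. d > 0 \<and> (f ^^ d) m = m"] that by (simp add: d_def)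
  define t where "t = map (\<lambda>k. (f ^^ k) m) [0..<d]"
  have len: "length t = d" and nth: "t ! k = (f ^^ k) m" if "k < d" for k
    using that by (simp_all add: t_def)
  have tO: "set t \<subseteq> ?O"
  proof
    fix y assume "y \<in> set t"
    then obtain k where "y = (f ^^ k) ((f ^^ a) x)" by (auto simp: t_def a)
    then have "y = (f ^^ (k + a)) x" by (simp add: funpow_add)
    then show "y \<in> ?O" by blast
  qed
  have ne: "(f ^^ i) m \<noteq> (f ^^ j) m" if "i < j" "j < d" for i j
    using funpow_cancel[OF assms(2,3) mA, of i "j - i"] least[of "j - i"] that by auto
  have "distinct t"
    unfolding t_def distinct_map using ne by (auto simp: inj_on_def) (metis nat_neq_iff)
  moreover have hd: "hd t = m" "t \<noteq> []" using d(1) len nth[of 0] by (auto simp: hd_conv_nth t_def)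
  moreover have "Min (set t) = m"
  proof (rule Min_eqI)
    show "m \<in> set t" using hd by (metis hd_in_set)
    show "m \<le> y" if "y \<in> set t" for y
      unfolding m_def using finO tO that by (intro Min_le) auto
  qed simp
  ultimately have mf: "minfirst t" by (simp add: minfirst_def)
  have cyc: "is_cycle f t"
    unfolding is_cycle_def
  proof (intro allI impI)
    fix k assume "k < length t"
    then show "f (t ! k) = t ! (Suc k mod length t)"
      using d by (cases "Suc k = d") (auto simp: len nth t_def)
  qed
  obtain e where e: "e > 0" "(f ^^ e) x = x" using funpow_periodic[OF assms] .
  \<comment> \<open>Return from \<open>m\<close> to \<open>x\<close>: after the \<open>a\<close>
    steps that led to \<open>m\<close>, this many further steps complete \<open>a\<close> full
    periods of \<open>x\<close>.\<close>
  have "(f ^^ (e * a - a)) m = (f ^^ (e * a - a + a)) x"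
    by (simp add: a funpow_add)
  also have "e * a - a + a = e * a" using e(1) by (cases e) auto
  finally have "x = (f ^^ (e * a - a)) m" using funpow_mult_periodic[OF e(2), of a] by simp
  then have "x \<in> {(f ^^ j) m |j. True}" by blast
  then have "x \<in> set t" using is_cycle_orbit[OF cyc, of m] hd by (metis hd_in_set)
  then show ?thesis using that mf cyc tO OA by blast
qed

text \<open>Fixed points appear as words of length 1, so for a permutation these words use up all
  letters.\<close>

definition cycles_of :: "nat list \<Rightarrow> nat list set" where
  "cycles_of w = {t. minfirst t \<and> set t \<subseteq> {1..length w} \<and> is_cycle (\<lambda>j. w ! (j - 1)) t}"

text \<open>The orbits are the letter sets of the cycles, and different cycles have different letter
  sets. An arbitrary family \<open>S\<close> is allowed because the lemma serves both directions of
  the bijection: for the cycles of a given permutation and for a given word partition.\<close>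

lemma cycle_type_eq:
  assumes "finite S" "\<forall>t\<in>S. minfirst t" "\<forall>s\<in>S. \<forall>t\<in>S. s \<noteq> t \<longrightarrow> set s \<inter> set t = {}"
    "(\<Union>t\<in>S. set t) = {1..length w}" "\<forall>t\<in>S. is_cycle (\<lambda>j. w ! (j - 1)) t"
  shows "cycle_type w = image_mset length (mset_set S)"
proof -
  let ?f = "\<lambda>j. w ! (j - 1)"
  have orb: "{(?f ^^ k) i |k. True} = set t" if "t \<in> S" "i \<in> set t" for i t
    by (rule is_cycle_orbit) (use assms(5) that in auto)
  have "(\<lambda>i. {(?f ^^ k) i |k. True}) ` {1..length w} = set ` S"
  proof (intro set_eqI iffI)
    fix X assume "X \<in> (\<lambda>i. {(?f ^^ k) i |k. True}) ` {1..length w}"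
    then obtain i where i: "i \<in> {1..length w}" "X = {(?f ^^ k) i |k. True}" by blast
    then obtain t where "t \<in> S" "i \<in> set t" using assms(4) by blast
    then show "X \<in> set ` S" using orb i by blast
  next
    fix X assume "X \<in> set ` S"
    then obtain t where t: "t \<in> S" "X = set t" by blast
    then have "hd t \<in> set t" using assms(2) by (auto simp: minfirst_def)
    moreover from this have "hd t \<in> {1..length w}" using assms(4) t by blast
    ultimately show "X \<in> (\<lambda>i. {(?f ^^ k) i |k. True}) ` {1..length w}"
      using orb[OF t(1)] t(2) by blast
  qed
  moreover have inj: "inj_on set S"
  proof (rule inj_onI)
    fix s t assume "s \<in> S" "t \<in> S" "set s = set t"
    moreover have "set s \<noteq> {}" using assms(2) \<open>s \<in> S\<close> by (auto simp: minfirst_def)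
    ultimately show "s = t" using assms(3) by (metis Int_absorb)
  qed
  moreover have "mset_set (set ` S) = image_mset set (mset_set S)"
    using image_mset_mset_set[OF inj] by simp
  ultimately have "cycle_type w = image_mset (\<lambda>t. card (set t)) (mset_set S)"
    by (simp add: cycle_type_def multiset.map_comp o_def)
  also have "\<dots> = image_mset length (mset_set S)"
    using assms(1,2) by (intro image_mset_cong) (simp add: minfirst_def distinct_card)
  finally show ?thesis .
qed

lemma cycles_of_word_partitions:
  assumes w: "w \<in> perms n" and q: "cycle_type w = mset q"
  shows "cycles_of w \<in> word_partitions {1..n} q"
proof -
  let ?f = "\<lambda>j. w ! (j - 1)"
  have lw: "length w = n" and dw: "distinct w" "set w = {1..n}"
    using w length_perms by (auto simp: perms_def)
  have inj: "inj_on ?f {1..n}" using dw lw by (auto simp: inj_on_def nth_eq_iff_index_eq)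
  have im: "?f ` {1..n} \<subseteq> {1..n}"
  proof
    fix x assume "x \<in> ?f ` {1..n}"
    then obtain j where "x = w ! (j - 1)" "j - 1 < length w" using lw by auto
    then have "x \<in> set w" by simp
    then show "x \<in> {1..n}" using dw by simp
  qed
  have fin: "finite (cycles_of w)"
    by (rule finite_subset[OF _ finite_subset_distinct[of "{1..n}"]]) (auto simp: cycles_of_def minfirst_def lw)
  have disj: "\<forall>s\<in>cycles_of w. \<forall>t\<in>cycles_of w. s \<noteq> t \<longrightarrow> set s \<inter> set t = {}"
    using is_cycle_unique unfolding cycles_of_def by blast
  have un: "(\<Union>t\<in>cycles_of w. set t) = {1..n}"
  proof
    show "{1..n} \<subseteq> (\<Union>t\<in>cycles_of w. set t)"
    proof
      fix x assume x: "x \<in> {1..n}"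
      obtain t where "minfirst t" "is_cycle ?f t" "set t \<subseteq> {1..n}" "x \<in> set t"
        using is_cycle_exists[OF finite_atLeastAtMost inj im x] .
      then show "x \<in> (\<Union>t\<in>cycles_of w. set t)"
        unfolding cycles_of_def lw by blast
    qed
  qed (use lw in \<open>auto simp: cycles_of_def\<close>)
  have "cycle_type w = image_mset length (mset_set (cycles_of w))"
    by (rule cycle_type_eq[OF fin _ disj]) (use un lw in \<open>auto simp: cycles_of_def\<close>)
  then show ?thesis using fin disj un q by (simp add: word_partitions_def) (simp add: cycles_of_def)
qed

lemma word_partitions_perm_exists:
  assumes S: "S \<in> word_partitions {1..n} q"
  obtains w where "w \<in> perms n" "\<forall>t\<in>S. is_cycle (\<lambda>j. w ! (j - 1)) t"
proof -
  have disj: "\<And>s t. s \<in> S \<Longrightarrow> t \<in> S \<Longrightarrow> s \<noteq> t \<Longrightarrow> set s \<inter> set t = {}"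
    and un: "(\<Union>t\<in>S. set t) = {1..n}" and mf: "\<And>t. t \<in> S \<Longrightarrow> minfirst t"
    using S by (auto simp: word_partitions_def)
  have "\<exists>t k. t \<in> S \<and> k < length t \<and> t ! k = i" if "i \<in> {1..n}" for i
  proof -
    have "i \<in> (\<Union>t\<in>S. set t)" using that by (simp only: un)
    then obtain t where "t \<in> S" "i \<in> set t" by blast
    then show ?thesis by (auto simp: in_set_conv_nth)
  qed
  \<comment> \<open>\<open>T i\<close> is the block containing the letter \<open>i\<close>, and
    \<open>K i\<close> is its index there.\<close>
  then obtain T K where TK: "\<And>i. i \<in> {1..n} \<Longrightarrow> T i \<in> S \<and> K i < length (T i) \<and> T i ! K i = i"
    by metis
  have TK_eq: "T (t ! k) = t \<and> K (t ! k) = k" if "t \<in> S" "k < length t" for t k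
  proof -
    have tk: "t ! k \<in> set t" using that by simp
    then have i: "t ! k \<in> {1..n}" unfolding un[symmetric] using that by blast
    note * = TK[OF i]
    have "t ! k \<in> set (T (t ! k))" using * by (metis nth_mem)
    then have "T (t ! k) = t" using disj[of t "T (t ! k)"] * that(1) tk by (metis IntI empty_iff)
    moreover from this have "K (t ! k) = k"
      using * that mf[OF that(1)] by (metis minfirst_def nth_eq_iff_index_eq)
    ultimately show ?thesis ..
  qed
  \<comment> \<open>Each letter is sent to its cyclic successor in its own block.\<close>
  define p where "p i = T i ! (Suc (K i) mod length (T i))" for i
  define w where "w = map p [1..<n + 1]"
  have w_nth: "w ! (i - 1) = p i" if "i \<in> {1..n}" for i
    unfolding w_def using that by (subst nth_map) (auto simp del: upt_Suc)
  have cyc: "\<forall>t\<in>S. is_cycle (\<lambda>j. w ! (j - 1)) t"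
    unfolding is_cycle_def
  proof (intro ballI allI impI)
    fix t k assume tk: "t \<in> S" "k < length t"
    then have "t ! k \<in> {1..n}" unfolding un[symmetric] using nth_mem by blast
    then have "w ! (t ! k - 1) = p (t ! k)" by (rule w_nth)
    then show "w ! (t ! k - 1) = t ! (Suc k mod length t)"
      using TK_eq[OF tk] by (simp add: p_def)
  qed
  have set_w: "set w = p ` {1..n}"
    by (simp add: w_def atLeastLessThanSuc_atLeastAtMost del: upt_Suc)
  have "set w = {1..n}"
  proof
    show "set w \<subseteq> {1..n}"
    proof
      fix x assume "x \<in> set w"
      then obtain i where i: "i \<in> {1..n}" "x = p i" unfolding set_w by blast
      have "Suc (K i) mod length (T i) < length (T i)"
        using TK[OF i(1)] by (intro mod_less_divisor) auto
      then have "x \<in> set (T i)" using i(2) by (simp add: p_def)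
      then show "x \<in> {1..n}" unfolding un[symmetric] using TK[OF i(1)] by blast
    qed
    show "{1..n} \<subseteq> set w"
    proof
      fix x assume x: "x \<in> {1..n}"
      \<comment> \<open>The preimage of \<open>x\<close> is its cyclic predecessor; adding the
        length before subtracting 1 handles the first letter of a block.\<close>
      let ?t = "T x" and ?k = "(K x + length (T x) - 1) mod length (T x)"
      have t: "?t \<in> S" "K x < length ?t" "?t ! K x = x" using TK[OF x] by auto
      have k: "?k < length ?t" using t by (intro mod_less_divisor) auto
      have "Suc (K x + length ?t - 1) = K x + length ?t" using t(2) by simp
      then have "Suc ?k mod length ?t = (K x + length ?t) mod length ?t"
        by (simp only: mod_Suc_eq)
      then have "p (?t ! ?k) = x" using TK_eq[OF t(1) k] t by (simp add: p_def)
      moreover have "?t ! ?k \<in> {1..n}" unfolding un[symmetric] using t(1) nth_mem[OF k] by blast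
      ultimately show "x \<in> set w" unfolding set_w by (metis imageI)
    qed
  qed
  moreover have "distinct w"
    using \<open>set w = {1..n}\<close> by (intro card_distinct) (simp add: w_def)
  ultimately show ?thesis using that cyc by (auto simp: perms_def)
qed

lemma card_cycle_type: "card {w \<in> perms n. cycle_type w = mset q} = card (word_partitions {1..n} q)"
proof -
  have "bij_betw cycles_of {w \<in> perms n. cycle_type w = mset q} (word_partitions {1..n} q)"
  proof (rule bij_betw_imageI)
    show "inj_on cycles_of {w \<in> perms n. cycle_type w = mset q}"
    proof (rule inj_onI, goal_cases)
      case (1 v w)
      then have l: "length v = n" "length w = n" using length_perms by auto
      have un: "(\<Union>t\<in>cycles_of v. set t) = {1..n}"
        using 1 cycles_of_word_partitions[of v n q] by (simp add: word_partitions_def)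
      have "v ! i = w ! i" if "i < n" for i
      proof -
        have "Suc i \<in> {1..n}" using that by auto
        then obtain t where t: "t \<in> cycles_of v" "Suc i \<in> set t" using un by blast
        then obtain k where k: "k < length t" "t ! k = Suc i" by (auto simp: in_set_conv_nth)
        have "is_cycle (\<lambda>j. v ! (j - 1)) t" "is_cycle (\<lambda>j. w ! (j - 1)) t"
          using t 1 by (auto simp: cycles_of_def)
        then have "v ! (t ! k - 1) = w ! (t ! k - 1)" using k(1) by (simp add: is_cycle_def)
        then show ?thesis using k by simp
      qed
      then show ?case using l by (simp add: nth_equalityI)
    qed
    show "cycles_of ` {w \<in> perms n. cycle_type w = mset q} = word_partitions {1..n} q"
    proof (intro set_eqI iffI)
      fix S assume S: "S \<in> word_partitions {1..n} q"
      then obtain w where w: "w \<in> perms n" "\<forall>t\<in>S. is_cycle (\<lambda>j. w ! (j - 1)) t"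
        by (rule word_partitions_perm_exists)
      have lw: "length w = n" using w length_perms by auto
      have un: "(\<Union>t\<in>S. set t) = {1..n}" using S by (simp add: word_partitions_def)
      have "cycle_type w = image_mset length (mset_set S)"
        by (rule cycle_type_eq) (use S w lw in \<open>auto simp: word_partitions_def\<close>)
      then have ct: "cycle_type w = mset q" using S by (simp add: word_partitions_def)
      have "S \<subseteq> cycles_of w" using S w lw by (auto simp: word_partitions_def cycles_of_def)
      moreover have "t \<in> S" if t: "t \<in> cycles_of w" for t
      proof -
        have "t \<noteq> []" "set t \<subseteq> {1..n}" using t lw by (auto simp: cycles_of_def minfirst_def)
        then obtain s where "s \<in> S" "hd t \<in> set s" using un by (metis UN_E hd_in_set subsetD)
        then have "s = t"
          using \<open>S \<subseteq> cycles_of w\<close> t \<open>t \<noteq> []\<close> hd_in_set[of t]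
          by (intro is_cycle_unique[of s t "\<lambda>j. w ! (j - 1)"]) (auto simp: cycles_of_def)
        then show ?thesis using \<open>s \<in> S\<close> by simp
      qed
      ultimately have "cycles_of w = S" by blast
      then show "S \<in> cycles_of ` {w \<in> perms n. cycle_type w = mset q}" using w ct by blast
    qed (use cycles_of_word_partitions in auto)
  qed
  then show ?thesis by (rule bij_betw_same_card)
qed

section \<open>The basis\<close>

text \<open>Under the lexicographic order this is the ordering of the tuples in
  \<open>Gamma\<close>: longer blocks first, through the negated length, and increasing first
  letters among blocks of equal length.\<close>

definition block_key :: "nat list \<Rightarrow> int \<times> nat" where
  "block_key t = (- int (length t), hd t)"

lemma word_partitions_inj_block_key:
  assumes "S \<in> word_partitions A q"
  shows "inj_on block_key S"
proof (rule inj_onI)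
  fix s t assume st: "s \<in> S" "t \<in> S" "block_key s = block_key t"
  then have "s \<noteq> []" "t \<noteq> []" "hd s = hd t"
    using assms by (auto simp: block_key_def word_partitions_def minfirst_def)
  then have "hd s \<in> set s \<inter> set t" by (metis IntI hd_in_set)
  then show "s = t" using assms st by (auto simp: word_partitions_def)
qed

lemma Gamma_facts:
  assumes "0 \<notin> set q" and T: "T \<in> Gamma n (lam q)"
  shows "set T \<in> word_partitions {1..n} q" "distinct T" "distinct (concat T)" "set (concat T) = {1..n}"
    "[] \<notin> set T" "length T = length q" "sorted (map block_key T)"
proof -
  show dT: "distinct (concat T)" "set (concat T) = {1..n}" using T by (auto simp: Gamma_def)
  have len: "map length T = rev (sort q)" using T by (simp add: Gamma_def lam_def)
  then show "length T = length q" by (metis length_map length_rev length_sort)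
  have "set (map length T) = set q" unfolding len by simp
  then show ne: "[] \<notin> set T" using assms(1) by force
  then show "distinct T" using dT by (simp add: distinct_concat_iff removeAll_id)
  have "image_mset length (mset_set (set T)) = mset (map length T)"
    using \<open>distinct T\<close> by (simp add: mset_set_set)
  then have "image_mset length (mset_set (set T)) = mset q" unfolding len by simp
  then show "set T \<in> word_partitions {1..n} q"
    using dT ne T by (auto simp: word_partitions_def minfirst_def distinct_concat_iff Gamma_def)
  show "sorted (map block_key T)"
    unfolding sorted_iff_nth_Suc
  proof (intro allI impI)
    fix k assume "Suc k < length (map block_key T)"
    then have k: "Suc k < length T" by simp
    have "sorted_wrt (\<ge>) (map length T)" unfolding len by (simp add: sorted_wrt_rev)
    then have "length (T ! Suc k) \<le> length (T ! k)"
      using k sorted_wrt_nth_less[of "(\<ge>)" "map length T" k "Suc k"] by simp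
    moreover have "length (T ! k) = length (T ! Suc k) \<Longrightarrow> hd (T ! k) < hd (T ! Suc k)"
      using T k unfolding Gamma_def by blast
    ultimately show "map block_key T ! k \<le> map block_key T ! Suc k"
      using k by (cases "length (T ! k) = length (T ! Suc k)") (auto simp: block_key_def less_eq_prod_def)
  qed
qed

text \<open>A tuple in \<open>Gamma\<close> is its set of blocks sorted by \<open>block_key\<close>.
  Disjoint blocks have different first letters, so the key is injective on them and the sorted list
  is unique.\<close>

lemma bij_betw_Gamma_word_partitions:
  assumes q: "0 \<notin> set q"
  shows "bij_betw set (Gamma n (lam q)) (word_partitions {1..n} q)"
proof (rule bij_betw_imageI)
  show "inj_on set (Gamma n (lam q))"
  proof (rule inj_onI)
    fix T U assume TU: "T \<in> Gamma n (lam q)" "U \<in> Gamma n (lam q)" "set T = set U"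
    note T = Gamma_facts[OF q TU(1)] and U = Gamma_facts[OF q TU(2)]
    have inj: "inj_on block_key (set T)" by (rule word_partitions_inj_block_key[OF T(1)])
    show "T = U"
      by (rule map_sorted_distinct_set_unique[of block_key])
        (use T U TU(3) inj in \<open>auto simp: distinct_map\<close>)
  qed
  show "set ` Gamma n (lam q) = word_partitions {1..n} q"
  proof (intro set_eqI iffI)
    fix S assume S: "S \<in> word_partitions {1..n} q"
    then have S': "finite S" "\<forall>t\<in>S. minfirst t" "\<forall>s\<in>S. \<forall>t\<in>S. s \<noteq> t \<longrightarrow> set s \<inter> set t = {}"
      "(\<Union>t\<in>S. set t) = {1..n}" "image_mset length (mset_set S) = mset q"
      by (auto simp: word_partitions_def)
    obtain xs where xs: "set xs = S" "distinct xs" using finite_distinct_list[OF S'(1)] by blast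
    define T where "T = sort_key block_key xs"
    have T: "set T = S" "distinct T" "sorted (map block_key T)" using xs by (simp_all add: T_def)
    have strict: "block_key (T ! i) < block_key (T ! j)" if "i < j" "j < length T" for i j
    proof -
      have "block_key (T ! i) \<le> block_key (T ! j)"
        using sorted_nth_mono[OF T(3), of i j] that by simp
      moreover have "block_key (T ! i) \<noteq> block_key (T ! j)"
        using word_partitions_inj_block_key[OF S] T(1,2) that
        by (metis inj_on_eq_iff nat_less_le nth_eq_iff_index_eq nth_mem order_less_trans)
      ultimately show ?thesis by simp
    qed
    have "sorted (rev (map length T))"
      unfolding sorted_rev_iff_nth_Suc
    proof (intro allI impI)
      fix i assume "Suc i < length (map length T)"
      then show "map length T ! Suc i \<le> map length T ! i"
        using strict[of i "Suc i"] by (auto simp: block_key_def less_prod_def)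
    qed
    moreover have "mset (rev (map length T)) = mset q"
      using S'(5) T by (simp flip: mset_set_set)
    ultimately have "sort q = rev (map length T)" by (metis properties_for_sort)
    then have len: "map length T = lam q" by (simp add: lam_def)
    have dc: "distinct (concat T)"
      using T S' by (intro distinct_concat) (auto simp: minfirst_def)
    have "hd (T ! k) < hd (T ! Suc k)" if "Suc k < length T" "length (T ! k) = length (T ! Suc k)" for k
      using strict[of k "Suc k"] that by (simp add: block_key_def less_prod_def)
    then have "T \<in> Gamma n (lam q)"
      using len dc S' T unfolding Gamma_def by (simp add: minfirst_def)
    then show "S \<in> set ` Gamma n (lam q)" using T by blast
  qed (use Gamma_facts[OF q] in auto)
qed

section \<open>Evaluating the products and separating them by coefficients\<close>

lemma QT_eq_left_normed_prod: "distinct (concat T) \<Longrightarrow> QT T = left_normed_prod T"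
  by (induction T) (simp_all add: QT_def left_normed_prod_def Qw_eq_left_normed)

lemma conv_omega_q_QT:
  assumes "n = sum_list q" "0 \<notin> set q" "T \<in> Gamma n (lam q)"
  shows "conv n (omega_q n q) (QT T) = scl (of_nat (prod_list q)) (sym_prod q (set T))"
proof
  fix z
  note T = Gamma_facts[OF assms(2,3)]
  show "conv n (omega_q n q) (QT T) z = scl (of_nat (prod_list q)) (sym_prod q (set T)) z"
    using lext_left_normed_prod_lie_unshuffle[OF T(3,5) assms(2) T(6), of z] T(4)
    unfolding conv_omega_q[OF assms(1)] QT_eq_left_normed_prod[OF T(3)] scl_def by metis
qed

lemma arrange_by_image:
  assumes "image_mset f M = mset ys"
  shows "\<exists>xs. mset xs = M \<and> map f xs = ys"
  using assms
proof (induction ys arbitrary: M)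
  case (Cons y ys)
  then obtain x N where "M = add_mset x N" "f x = y" "image_mset f N = mset ys"
    by (metis msed_map_invR mset.simps(2))
  then show ?case using Cons.IH[of N] by (metis list.simps(9) mset.simps(2))
qed simp

text \<open>The functionals dual to the symmetrised products are coefficients of single words.\<close>

lemma word_partitions_dual_word:
  assumes S: "S \<in> word_partitions A q"
  obtains z where "\<And>S'. S' \<in> word_partitions A q \<Longrightarrow> sym_prod q S' z = (if S' = S then 1 else 0 :: 'a::field)"
proof -
  have "image_mset length (mset_set S) = mset q" "finite S" using S by (auto simp: word_partitions_def)
  \<comment> \<open>The dual word is a concatenation of the blocks in an order whose lengths spell
    \<open>q\<close>, which may differ from the order used in \<open>Gamma\<close>.\<close>
  then obtain ts where ts: "mset ts = mset_set S" "map length ts = q" using arrange_by_image by blast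
  have set_ts: "set ts = S" using ts(1) \<open>finite S\<close> by (metis finite_set_mset_mset_set set_mset_mset)
  have "length ts = card S" using ts(1) by (metis size_mset size_mset_set)
  then have dts: "distinct ts" using set_ts by (simp add: card_distinct)
  have "sym_prod q S' (concat ts) = (if S' = S then 1 else 0 :: 'a)" if S': "S' \<in> word_partitions A q" for S'
  proof -
    have "size (image_mset length (mset_set S')) = length q" using S' by (simp add: word_partitions_def)
    then have "card S' = length q" by simp
    then show ?thesis
      using sym_prod_coefficient[of S' q ts, where ?'a = 'a] S S' ts(2) set_ts dts by (auto simp: word_partitions_def)
  qed
  then show ?thesis using that by blast
qed

lemma sum_comb_apply: "(\<Sum>i\<in>I. f i :: 'a::field comb) z = (\<Sum>i\<in>I. f i z)"
  by (induction I rule: infinite_finite_induct) simp_all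

interpretation comb: vector_space "scl :: 'a::field \<Rightarrow> 'a comb \<Rightarrow> 'a comb"
  by unfold_locales (auto simp: scl_def algebra_simps fun_eq_iff)

theorem mainTheorem4:
  fixes n :: nat and q :: "nat list"
  assumes "composition n q"
    and "\<forall>i\<in>set q. \<not> CHAR('a::field) dvd i"
  shows "inj_on (\<lambda>T. conv n (omega_q n q) (QT T) :: 'a comb) (Gamma n (lam q))
    \<and> \<not> module.dependent (scl :: 'a \<Rightarrow> 'a comb \<Rightarrow> 'a comb)
          ((\<lambda>T. conv n (omega_q n q) (QT T)) ` Gamma n (lam q))
    \<and> module.span (scl :: 'a \<Rightarrow> 'a comb \<Rightarrow> 'a comb)
          ((\<lambda>T. conv n (omega_q n q) (QT T)) ` Gamma n (lam q)) = Lie n q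
    \<and> vector_space.dim (scl :: 'a \<Rightarrow> 'a comb \<Rightarrow> 'a comb) (Lie n q :: 'a comb set)
        = fact n div qq q
    \<and> card {w \<in> perms n. cycle_type w = mset (lam q)} = fact n div qq q"
proof -
  have n: "n = sum_list q" and q0: "0 \<notin> set q" using assms(1) by (auto simp: composition_def)
  let ?G = "Gamma n (lam q)" and ?W = "word_partitions {1..n} q"
  define F :: "nat list list \<Rightarrow> 'a comb" where "F T = conv n (omega_q n q) (QT T)" for T
  define c :: 'a where "c = of_nat (prod_list q)"
  \<comment> \<open>This is where the characteristic matters: every part of \<open>q\<close> is
    nonzero in the field, hence so is their product.\<close>
  have c: "c \<noteq> 0"
    unfolding c_def using assms(2) by (induction q) (auto simp: of_nat_eq_0_iff_char_dvd)
  have F: "F T = scl c (sym_prod q (set T))" if "T \<in> ?G" for T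
    unfolding F_def c_def by (rule conv_omega_q_QT[OF n q0 that])
  have bij: "bij_betw set ?G ?W" by (rule bij_betw_Gamma_word_partitions[OF q0])
  have finW: "finite ?W" by (simp add: finite_word_partitions)
  then have finG: "finite ?G" using bij bij_betw_finite by blast
  \<comment> \<open>A single coefficient separates \<open>F T\<close> from all other members of the
    family; this gives injectivity as well as independence.\<close>
  have dual: "\<exists>z. \<forall>U\<in>?G. F U z = (if U = T then c else 0)" if T: "T \<in> ?G" for T
  proof -
    have "set T \<in> ?W" using bij T by (auto simp: bij_betw_def)
    then obtain z where z: "\<And>S'. S' \<in> ?W \<Longrightarrow> sym_prod q S' z = (if S' = set T then 1 else 0 :: 'a)"
      using word_partitions_dual_word[where ?'a = 'a] by blast
    have "F U z = (if U = T then c else 0)" if U: "U \<in> ?G" for U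
    proof -
      have "set U \<in> ?W" using bij U by (auto simp: bij_betw_def)
      moreover have "set U = set T \<longleftrightarrow> U = T" using bij U T by (auto simp: bij_betw_def inj_on_eq_iff)
      ultimately show ?thesis using z F[OF U] by (simp add: scl_def)
    qed
    then show ?thesis by blast
  qed
  have inj: "inj_on F ?G"
  proof (rule inj_onI)
    fix T U assume TU: "T \<in> ?G" "U \<in> ?G" "F T = F U"
    obtain z where "\<forall>U\<in>?G. F U z = (if U = T then c else 0)" using dual[OF TU(1)] by blast
    then show "T = U" using TU c by (metis (full_types))
  qed
  have indep: "\<not> comb.dependent (F ` ?G)"
  proof
    assume "comb.dependent (F ` ?G)"
    then obtain u T where u: "T \<in> ?G" "u (F T) \<noteq> 0" "(\<Sum>v\<in>F ` ?G. scl (u v) v) = 0"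
      using comb.dependent_finite[of "F ` ?G"] finG by auto
    obtain z where z: "\<forall>U\<in>?G. F U z = (if U = T then c else 0)" using dual[OF u(1)] by blast
    have "0 = (\<Sum>v\<in>F ` ?G. scl (u v) v) z" using u(3) by simp
    also have "\<dots> = (\<Sum>U\<in>?G. u (F U) * F U z)"
      by (simp add: sum_comb_apply scl_def sum.reindex[OF inj])
    also have "\<dots> = (\<Sum>U\<in>?G. if U = T then u (F T) * c else 0)"
      using z by (intro sum.cong refl) auto
    also have "\<dots> = u (F T) * c" using u(1) finG by simp
    finally show False using u(2) c by simp
  qed
  have span: "comb.span (F ` ?G) = Lie n q"
  proof
    have sub: "comb.subspace (Lie n q :: 'a comb set)"
    proof (rule comb.subspaceI)
      show "0 \<in> Lie n q"
        unfolding Lie_def by (intro CollectI exI[of _ 0]) (auto simp: conv_act group_alg_def fun_eq_iff)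
      show "x + y \<in> Lie n q" if xy: "x \<in> Lie n q" "y \<in> Lie n q" for x y :: "'a comb"
      proof -
        obtain a b where ab: "x = conv n (omega_q n q) a" "y = conv n (omega_q n q) b"
          "a \<in> group_alg n" "b \<in> group_alg n" using xy unfolding Lie_def by blast
        have "x + y = conv n (omega_q n q) (a + b)"
          by (auto simp: ab conv_act fun_eq_iff sum.distrib algebra_simps)
        moreover have "a + b \<in> group_alg n" using ab by (simp add: group_alg_def)
        ultimately show ?thesis unfolding Lie_def by blast
      qed
      show "scl d x \<in> Lie n q" if x: "x \<in> Lie n q" for d and x :: "'a comb"
      proof -
        obtain a where a: "x = conv n (omega_q n q) a" "a \<in> group_alg n" using x by (auto simp: Lie_def)
        have "scl d x = conv n (omega_q n q) (scl d a)"
          by (auto simp: a conv_act scl_def fun_eq_iff sum_distrib_left algebra_simps)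
        moreover have "scl d a \<in> group_alg n" using a by (simp add: group_alg_def scl_def)
        ultimately show ?thesis unfolding Lie_def by blast
      qed
    qed
    have "F T \<in> Lie n q" if "T \<in> ?G" for T
    proof -
      note T = Gamma_facts[OF q0 that]
      have "supported {1..n} (QT T :: 'a comb)"
        using supported_left_normed_prod[OF T(3)] T(4) QT_eq_left_normed_prod[OF T(3)] by metis
      then have "(QT T :: 'a comb) \<in> group_alg n" by (simp add: group_alg_def supported_def perms_eq)
      then show ?thesis unfolding Lie_def F_def by blast
    qed
    then show "comb.span (F ` ?G) \<subseteq> Lie n q" using sub by (intro comb.span_minimal) auto
    have sym_prod: "sym_prod q S \<in> comb.span (F ` ?G)" if "S \<in> ?W" for S
    proof -
      obtain T where T: "T \<in> ?G" "set T = S" using \<open>S \<in> ?W\<close> bij by (metis bij_betw_imp_surj_on imageE)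
      have "sym_prod q S = scl (inverse c) (F T)" using F[OF T(1)] T(2) c by (simp add: scl_def fun_eq_iff)
      then show ?thesis using T by (simp add: comb.span_scale comb.span_base)
    qed
    have lie_unshuffle: "lie_unshuffle q w \<in> comb.span (F ` ?G)" if w: "w \<in> perms n" for w
    proof -
      have "distinct w" "set w = {1..n}" "sum_list q = length w" using w length_perms[OF w] n by (auto simp: perms_def)
      then have "lie_unshuffle q w z = (\<Sum>S\<in>?W. (\<Prod>v\<in>S. left_normed (filter (\<lambda>x. x \<in> set v) w) v) * (sym_prod q S z :: 'a))" for z
        using lie_unshuffle_expand[of w q z, where ?'a = 'a] q0 by simp
      then have "lie_unshuffle q w = (\<Sum>S\<in>?W. scl (\<Prod>v\<in>S. left_normed (filter (\<lambda>x. x \<in> set v) w) v) (sym_prod q S :: 'a comb))"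
        by (intro ext) (simp add: sum_comb_apply scl_def)
      then show ?thesis using sym_prod by (simp add: comb.span_sum comb.span_scale)
    qed
    show "Lie n q \<subseteq> comb.span (F ` ?G)"
    proof
      fix x :: "'a comb" assume "x \<in> Lie n q"
      then obtain y where "x = conv n (omega_q n q) y" by (auto simp: Lie_def)
      then have "x = (\<Sum>w\<in>perms n. scl (y w) (lie_unshuffle q w))"
        by (intro ext) (simp add: conv_omega_q[OF n] lext_def perms_eq sum_comb_apply scl_def)
      then show "x \<in> comb.span (F ` ?G)" using lie_unshuffle by (simp add: comb.span_sum comb.span_scale)
    qed
  qed
  have cw: "card ?W * qq q = fact n" by (subst card_word_partitions) (use q0 n in simp_all)
  \<comment> \<open>Nonvanishing is read off from the product formula, whose value is a
    factorial.\<close>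
  have "qq q \<noteq> 0"
  proof
    assume "qq q = 0"
    then have "(fact n :: nat) = 0" using cw by simp
    then show False by simp
  qed
  then have cW: "card ?W = fact n div qq q"
    unfolding cw[symmetric] by (rule nonzero_mult_div_cancel_right[symmetric])
  have "comb.dim (Lie n q :: 'a comb set) = card (F ` ?G)"
    using comb.dim_span_eq_card_independent[OF indep] span by simp
  then have dim: "comb.dim (Lie n q :: 'a comb set) = fact n div qq q"
    using card_image[OF inj] bij_betw_same_card[OF bij] cW by simp
  have "mset (lam q) = mset q" by (simp add: lam_def)
  then have ct: "card {w \<in> perms n. cycle_type w = mset (lam q)} = fact n div qq q"
    using card_cycle_type[of n q] cW by simp
  show ?thesis
    using inj indep span dim ct unfolding F_def by blast
qed

end
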